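(* For every $n\ge 2$ the following hold: (i) $CD(H_n,L_n)=A_1^{(n)}$; (ii) $CD(K_nx_n\sqcup K_nx_n^2,\,L_n)=A_2^{(n)}$; (iii) $CD\big(z_nH_n\sqcup x_nz_nx_n^{-1}H_n\sqcup x_n^2z_nx_n^{-2}H_n,\,L_n\big)=A_3^{(n)}$; (iv) $CD(L_ny_n,M_n)=A_4^{(n+1)}$.
   Context: Tree and groups. Let $X=\{0,1,2\}$ and let $\mathcal T$ be the rooted ternary tree whose vertices are the finite words over $X$ (the children of $w$ are $w0,w1,w2$); $\mathcal T_n$ is the tree truncated at level $n$, with $\mathrm{Aut}(\mathcal T_1)=S_3$. Automorphisms act on the right, written $(w)\sigma$, and $\sigma\tau$ means first $\sigma$ then $\tau$. For $n\ge2$ every $\sigma\in\mathrm{Aut}(\mathcal T_n)$ is written uniquely as $\sigma=(\sigma_0,\sigma_1,\sigma_2)\pi$ with $\pi\in S_3$, $\sigma_i\in\mathrm{Aut}(\mathcal T_{n-1})$, meaning $(iw)\sigma=((i)\pi)((w)\sigma_i)$; hence $(\sigma_0,\sigma_1,\sigma_2)\pi\cdot(\tau_0,\tau_1,\tau_2)\rho=(\sigma_0\tau_{(0)\pi},\sigma_1\tau_{(1)\pi},\sigma_2\tau_{(2)\pi})\pi\rho$; write $(\sigma_0,\sigma_1,\sigma_2)$ when $\pi=\mathrm{id}$. $\mathrm{Aut}(\mathcal T_{n-1})$ is embedded in $\mathrm{Aut}(\mathcal T_n)$ via $\sigma\mapsto(\sigma,\mathrm{id},\mathrm{id})$. Define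 $x_1=(0,1,2)$, $y_1=(0,1)$, $z_1=\mathrm{id}$, and for $n\ge2$: $x_n=(\mathrm{id},\mathrm{id},x_{n-1})(0,1,2)$, $y_n=(\mathrm{id},y_{n-1},x_{n-1})(0,1)$, $z_n=(y_{n-1},y_{n-1},x_{n-1})$. Let $L_1=\langle x_1\rangle$, $M_1=S_3$, and for $n\ge2$: $L_n=\langle x_n,z_n,L_{n-1}\rangle$, $M_n=\langle x_n,y_n,z_n,L_{n-1}\rangle$. $H_n$ is the normal closure of $L_{n-1}$ in $L_n$, and $K_n$ is the normal closure in $L_n$ of $\langle H_n,z_n\rangle$. Cycle data of group subsets. The cycle type of $\sigma\in\mathrm{Aut}(\mathcal T_n)$ is the partition of $3^n$ given by the cycle lengths of the permutation $\sigma$ induces on the level-$n$ vertices $X^n$. For finite $S\subseteq G\le\mathrm{Aut}(\mathcal T_n)$, $CD(S,G)$ is the function on partitions $\lambda$ of $3^n$ given by $\lambda\mapsto |\{\sigma\in S:\ \text{cycle type of }\sigma=\lambda\}|/|G|$. Markov process. A typed partition is a finite multiset of pairs $(\tau,m)$ with $\tau\in\{s,n\}$ and $m\in\mathbb Z_{>0}$. One step of the process replaces each pair independently by a random multiset: $(s,m)\mapsto\{(s,3m)\}$ with probability $2/3$, $\{(s,m),(s,m),(s,m)\}$ with probability $1/12$, $\{(s,m),(n,m),(n,m)\}$ with probability $1/4$; $(n,m)\mapsto\{(n,2m),(s,m)\}$ with probability $1/2$, $\{(s,2m),(n,m)\}$ with probability $1/2$. For a typed partition $P$, a weight $w>0$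 and $k\ge0$, let $D_k(P,w)$ be the function sending a partition $\lambda$ (multiset of positive integers) to $w$ times the probability that, starting from $P$ and applying $k$ steps, the resulting multiset of integers $m$ (types forgotten) equals $\lambda$. Set $A_1^{(n)}=D_{n-1}(\{(s,1),(s,1),(s,1)\},\tfrac1{12})$, $A_2^{(n)}=D_{n-1}(\{(s,3)\},\tfrac23)$, $A_3^{(n)}=D_{n-1}(\{(n,1),(n,1),(s,1)\},\tfrac14)$, $A_4^{(n+1)}=D_{n}(\{(n,1)\},\tfrac12)$. Equalities are equalities of functions on partitions of $3^n$. *)

theory Defs
  imports
    "HOL-Probability.Probability"
    "HOL-Algebra.Generated_Groups"
    "HOL-Combinatorics.Cycles"
    "HOL-Combinatorics.Orbits"
    "HOL-Library.Numeral_Type"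
begin

text \<open>
  The alphabet \<open>{0, 1, 2}\<close> is the numeral type \<^typ>\<open>3\<close>, and vertices are words, read from the
  root. Automorphisms of the truncated tree are permutations of its vertices, extended by the
  identity to all words. They act on the right, so the product
  \<open>\<sigma> \<otimes> \<tau>\<close> (first \<open>\<sigma>\<close>, then \<open>\<tau>\<close>) is the function \<open>\<tau> \<circ> \<sigma>\<close>.
\<close>

type_synonym word = "3 list"
type_synonym aut = "word \<Rightarrow> word"

definition verts :: "nat \<Rightarrow> word set" where
  "verts n = {w. length w \<le> n}"

definition level :: "nat \<Rightarrow> word set" where
  "level n = {w. length w = n}"

definition child :: "word \<Rightarrow> word \<Rightarrow> bool" where
  "child v w \<longleftrightarrow> (\<exists>i. w = v @ [i])"

definition AutT :: "nat \<Rightarrow> aut monoid" where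
  "AutT n = \<lparr>carrier = {\<sigma>. \<sigma> permutes verts n \<and> \<sigma> [] = [] \<and>
                 (\<forall>v\<in>verts n. \<forall>w\<in>verts n. child v w \<longleftrightarrow> child (\<sigma> v) (\<sigma> w))},
             mult = (\<lambda>\<sigma> \<tau>. \<tau> \<circ> \<sigma>), one = id\<rparr>"

text \<open>
  \<open>wr n a b c \<pi>\<close> is the automorphism \<open>(a, b, c)\<pi>\<close> of the tree truncated at level \<open>n\<close>, where
  \<open>a\<close>, \<open>b\<close>, \<open>c\<close> are automorphisms of the tree truncated at level \<open>n - 1\<close>. Words longer than \<open>n\<close>
  have to be fixed explicitly, since \<open>\<pi>\<close> would change their first letter.
\<close>

fun wr :: "nat \<Rightarrow> aut \<Rightarrow> aut \<Rightarrow> aut \<Rightarrow> (3 \<Rightarrow> 3) \<Rightarrow> aut" where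
  "wr n a b c \<pi> [] = []"
| "wr n a b c \<pi> (i # w) =
     (if length (i # w) \<le> n
      then \<pi> i # (if i = 0 then a else if i = 1 then b else c) w
      else i # w)"

definition emb :: "nat \<Rightarrow> aut \<Rightarrow> aut" where
  "emb n \<sigma> = wr n \<sigma> id id id"

text \<open>In the recursive definitions below the equations for index \<open>0\<close> are irrelevant fillers.\<close>

fun xg :: "nat \<Rightarrow> aut" where
  "xg 0 = id"
| "xg (Suc 0) = wr 1 id id id (cycle_of_list [0, 1, 2])"
| "xg (Suc (Suc n)) = wr (Suc (Suc n)) id id (xg (Suc n)) (cycle_of_list [0, 1, 2])"

fun yg :: "nat \<Rightarrow> aut" where
  "yg 0 = id"
| "yg (Suc 0) = wr 1 id id id (cycle_of_list [0, 1])"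
| "yg (Suc (Suc n)) = wr (Suc (Suc n)) id (yg (Suc n)) (xg (Suc n)) (cycle_of_list [0, 1])"

fun zg :: "nat \<Rightarrow> aut" where
  "zg 0 = id"
| "zg (Suc 0) = id"
| "zg (Suc (Suc n)) = wr (Suc (Suc n)) (yg (Suc n)) (yg (Suc n)) (xg (Suc n)) id"

fun Lg :: "nat \<Rightarrow> aut set" where
  "Lg 0 = {id}"
| "Lg (Suc 0) = generate (AutT 1) {xg 1}"
| "Lg (Suc (Suc n)) =
     generate (AutT (Suc (Suc n)))
       ({xg (Suc (Suc n)), zg (Suc (Suc n))} \<union> emb (Suc (Suc n)) ` Lg (Suc n))"

fun Mg :: "nat \<Rightarrow> aut set" where
  "Mg 0 = {id}"
| "Mg (Suc 0) = carrier (AutT 1)"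
| "Mg (Suc (Suc n)) =
     generate (AutT (Suc (Suc n)))
       ({xg (Suc (Suc n)), yg (Suc (Suc n)), zg (Suc (Suc n))} \<union> emb (Suc (Suc n)) ` Lg (Suc n))"

definition LG :: "nat \<Rightarrow> aut monoid" where
  "LG n = (AutT n)\<lparr>carrier := Lg n\<rparr>"

definition normal_closure :: "('a, 'b) monoid_scheme \<Rightarrow> 'a set \<Rightarrow> 'a set" where
  "normal_closure G S = \<Inter>{N. N \<lhd> G \<and> S \<subseteq> N}"

definition Hg :: "nat \<Rightarrow> aut set" where
  "Hg n = normal_closure (LG n) (emb n ` Lg (n - 1))"

definition Kg :: "nat \<Rightarrow> aut set" where
  "Kg n = normal_closure (LG n) (generate (LG n) (Hg n \<union> {zg n}))"


text \<open>
  \<^term>\<open>orbit \<sigma> w\<close> is the cycle of \<open>\<sigma>\<close> through \<open>w\<close>; it is \<open>{w}\<close> when \<open>w\<close> is fixed.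
\<close>

definition cycle_type :: "nat \<Rightarrow> aut \<Rightarrow> nat multiset" where
  "cycle_type n \<sigma> = image_mset card (mset_set (orbit \<sigma> ` level n))"

definition partitions :: "nat \<Rightarrow> nat multiset set" where
  "partitions N = {p. (\<forall>m\<in>#p. 0 < m) \<and> sum_mset p = N}"

definition CD :: "nat \<Rightarrow> aut set \<Rightarrow> aut set \<Rightarrow> nat multiset \<Rightarrow> real" where
  "CD n S G p = real (card {\<sigma> \<in> S. cycle_type n \<sigma> = p}) / real (card G)"


text \<open>\<open>Ts\<close> and \<open>Tn\<close> are the types \<open>s\<close> and \<open>n\<close>.\<close>

datatype ptype = Ts | Tn

type_synonym typed_partition = "(ptype \<times> nat) multiset"

fun branch :: "ptype \<times> nat \<Rightarrow> typed_partition pmf" where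
  "branch (Ts, m) = pmf_of_list
     [({#(Ts, 3 * m)#}, 2/3),
      ({#(Ts, m), (Ts, m), (Ts, m)#}, 1/12),
      ({#(Ts, m), (Tn, m), (Tn, m)#}, 1/4)]"
| "branch (Tn, m) = pmf_of_list
     [({#(Tn, 2 * m), (Ts, m)#}, 1/2),
      ({#(Ts, 2 * m), (Tn, m)#}, 1/2)]"

definition indep_add :: "ptype \<times> nat \<Rightarrow> typed_partition pmf \<Rightarrow> typed_partition pmf" where
  "indep_add p Q = bind_pmf (branch p) (\<lambda>A. map_pmf (\<lambda>B. A + B) Q)"

text \<open>
  One step of the process: the sum of independent samples of \<^const>\<open>branch\<close>, one for each
  element of the multiset. Lemma \<open>step_add_mset\<close> is the recursion that determines it.
\<close>

definition step :: "typed_partition \<Rightarrow> typed_partition pmf" where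
  "step P = fold_mset indep_add (return_pmf {#}) P"

interpretation indep_add: comp_fun_commute indep_add
proof
  fix p q :: "ptype \<times> nat"
  show "indep_add q \<circ> indep_add p = indep_add p \<circ> indep_add q"
  proof
    fix Q
    have "indep_add q (indep_add p Q) =
        bind_pmf (branch q) (\<lambda>A. bind_pmf (branch p) (\<lambda>B. map_pmf (\<lambda>C. A + (B + C)) Q))"
      by (simp add: indep_add_def map_bind_pmf pmf.map_comp o_def)
    also have "\<dots> =
        bind_pmf (branch p) (\<lambda>B. bind_pmf (branch q) (\<lambda>A. map_pmf (\<lambda>C. A + (B + C)) Q))"
      by (rule bind_commute_pmf)
    also have "\<dots> = indep_add p (indep_add q Q)"
      by (simp add: indep_add_def map_bind_pmf pmf.map_comp o_def add.left_commute)
    finally show "(indep_add q \<circ> indep_add p) Q = (indep_add p \<circ> indep_add q) Q"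
      by simp
  qed
qed

lemma step_empty: "step {#} = return_pmf {#}"
  by (simp add: step_def)

lemma step_add_mset:
  "step (add_mset p P) = bind_pmf (branch p) (\<lambda>A. map_pmf (\<lambda>B. A + B) (step P))"
  by (simp add: step_def indep_add_def)

lemma branch_wf:
  "pmf_of_list_wf
     [({#(Ts, 3 * m)#}, 2/3 :: real),
      ({#(Ts, m), (Ts, m), (Ts, m)#}, 1/12),
      ({#(Ts, m), (Tn, m), (Tn, m)#}, 1/4)]"
  "pmf_of_list_wf
     [({#(Tn, 2 * m), (Ts, m)#}, 1/2 :: real),
      ({#(Ts, 2 * m), (Tn, m)#}, 1/2)]"
  by (simp_all add: pmf_of_list_wf_def)

fun steps :: "nat \<Rightarrow> typed_partition \<Rightarrow> typed_partition pmf" where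
  "steps 0 P = return_pmf P"
| "steps (Suc k) P = bind_pmf (steps k P) step"

definition D :: "nat \<Rightarrow> typed_partition \<Rightarrow> real \<Rightarrow> nat multiset \<Rightarrow> real" where
  "D k P w p = w * pmf (map_pmf (image_mset snd) (steps k P)) p"

definition A1 :: "nat \<Rightarrow> nat multiset \<Rightarrow> real" where
  "A1 n = D (n - 1) {#(Ts, 1), (Ts, 1), (Ts, 1)#} (1/12)"

definition A2 :: "nat \<Rightarrow> nat multiset \<Rightarrow> real" where
  "A2 n = D (n - 1) {#(Ts, 3)#} (2/3)"

definition A3 :: "nat \<Rightarrow> nat multiset \<Rightarrow> real" where
  "A3 n = D (n - 1) {#(Tn, 1), (Tn, 1), (Ts, 1)#} (1/4)"

definition A4 :: "nat \<Rightarrow> nat multiset \<Rightarrow> real" where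
  "A4 n = D (n - 1) {#(Tn, 1)#} (1/2)"

end

theory Submission
  imports Defs
begin

text \<open>
  Let the sign of an automorphism be the sign of its action on the first level. Then \<open>M\<^sub>n\<close> consists
  of the automorphisms \<open>(a, b, c)\<pi>\<close> with \<open>a\<close>, \<open>b\<close>, \<open>c\<close> in \<open>M\<^sub>n\<^sub>-\<^sub>1\<close> whose signs multiply to the
  sign of \<open>\<pi>\<close>, and \<open>L\<^sub>n\<close> is its even half. Fixing \<open>\<pi>\<close> and the three signs cuts \<open>L\<^sub>n\<close>, and likewise
  the odd half \<open>L\<^sub>n y\<^sub>n\<close>, into twelve cells of equal size, and all sets in the theorem are unions of
  cells. In a uniformly distributed element of a cell, \<open>a\<close>, \<open>b\<close>, \<open>c\<close> are independent and uniform
  on their cosets. A cycle of \<open>\<pi>\<close> of length \<open>k\<close> contributes \<open>k\<close> times the cycle type of the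
  product of the components along it, and such a product is again uniform on the coset given
  by its sign. This is one step of the process, with type \<open>s\<close> for even and \<open>n\<close> for odd, so induction
  on \<open>n\<close> identifies the cycle statistics of \<open>L\<^sub>n\<close> and \<open>L\<^sub>n y\<^sub>n\<close> with \<open>n\<close> steps of the process.
\<close>

section \<open>The branching process\<close>

text \<open>Convolution in the monoid of multisets: the law of a sum of two independent
  samples.\<close>

definition conv :: "'a multiset pmf \<Rightarrow> 'a multiset pmf \<Rightarrow> 'a multiset pmf" where
  "conv A B = bind_pmf A (\<lambda>a. map_pmf (\<lambda>b. a + b) B)"

lemma conv_altdef: "conv A B = bind_pmf A (\<lambda>a. bind_pmf B (\<lambda>b. return_pmf (a + b)))"
  by (simp add: conv_def map_pmf_def)

lemma conv_commute: "conv A B = conv B A"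
  unfolding conv_altdef by (subst bind_commute_pmf) (simp add: add.commute)

lemma conv_assoc: "conv (conv A B) C = conv A (conv B C)"
  unfolding conv_altdef by (simp add: bind_assoc_pmf bind_return_pmf add.assoc)

lemma conv_left_commute: "conv A (conv B C) = conv B (conv A C)"
  by (metis conv_assoc conv_commute)

lemmas conv_ac = conv_assoc conv_commute conv_left_commute

lemma map_pmf_conv_image_mset:
  "map_pmf (image_mset f) (conv A B) = conv (map_pmf (image_mset f) A) (map_pmf (image_mset f) B)"
  unfolding conv_altdef map_pmf_def by (simp add: bind_assoc_pmf bind_return_pmf)

lemma step_add_mset_conv: "step (add_mset p P) = conv (branch p) (step P)"
  by (simp add: step_add_mset conv_def)

lemma step_single: "step {#p#} = branch p"
  by (simp add: step_add_mset_conv step_empty conv_altdef bind_return_pmf bind_return_pmf')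

lemma step_add: "step (P + Q) = conv (step P) (step Q)"
  by (induction P) (simp_all add: step_empty step_add_mset_conv conv_assoc,
      simp add: conv_altdef bind_return_pmf bind_return_pmf')

text \<open>The branching property. Pairs never interact within a step, and iteration inherits this
  independence.\<close>

lemma steps_add: "steps k (P + Q) = conv (steps k P) (steps k Q)"
proof (induction k)
  case 0
  show ?case by (simp add: conv_altdef bind_return_pmf)
next
  case (Suc k)
  \<comment> \<open>Four draws occur, and the two sides differ only in whether \<open>b\<close> is
    drawn before or after \<open>c\<close>.\<close>
  have "steps (Suc k) (P + Q) =
      bind_pmf (steps k P) (\<lambda>a. bind_pmf (steps k Q) (\<lambda>b. bind_pmf (step a) (\<lambda>c.
        bind_pmf (step b) (\<lambda>d. return_pmf (c + d)))))"
    by (simp add: Suc) (simp add: conv_altdef bind_assoc_pmf bind_return_pmf step_add)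
  also have "\<dots> = conv (steps (Suc k) P) (steps (Suc k) Q)"
    by (simp add: conv_altdef bind_assoc_pmf bind_return_pmf)
       (intro bind_pmf_cong refl bind_commute_pmf)
  finally show ?case .
qed

text \<open>\<open>steps\<close> adds its new step at the end, while the recursion on the depth of
  the tree splits off the action on the first level, which corresponds to the first step.\<close>

lemma steps_Suc_first: "steps (Suc k) P = bind_pmf (step P) (steps k)"
proof (induction k)
  case 0
  show ?case by (simp add: bind_return_pmf bind_return_pmf')
next
  case (Suc k)
  show ?case
    by (subst steps.simps(2), subst Suc) (simp add: bind_assoc_pmf fun_eq_iff cong: bind_pmf_cong)
qed

lemma pmf_bind_pmf_of_list:
  assumes "pmf_of_list_wf xs"
  shows "pmf (bind_pmf (pmf_of_list xs) g) y = (\<Sum>(x, p)\<leftarrow>xs. p * pmf (g x) y)"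
proof -
  let ?A = "set (map fst xs)"
  have "pmf (bind_pmf (pmf_of_list xs) g) y = (\<Sum>x\<in>?A. pmf (g x) y * pmf (pmf_of_list xs) x)"
    unfolding pmf_bind using set_pmf_of_list[OF assms]
    by (subst integral_measure_pmf[of ?A]) (auto simp: mult.commute)
  also have "\<dots> = (\<Sum>x\<in>?A. \<Sum>z\<leftarrow>xs. if fst z = x then snd z * pmf (g x) y else 0)"
    by (intro sum.cong refl)
       (simp add: pmf_pmf_of_list[OF assms] sum_list_map_filter' sum_list_const_mult[symmetric]
          if_distrib mult.commute cong: if_cong)
  also have "\<dots> = (\<Sum>(x, p)\<leftarrow>xs. p * pmf (g x) y)"
  proof -
    \<comment> \<open>Induction on \<open>xs\<close> needs a set that stays the same when the list
      gets shorter, hence any finite \<open>A\<close> containing the listed values.\<close>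
    have "(\<Sum>x\<in>A. \<Sum>z\<leftarrow>xs. if fst z = x then snd z * pmf (g x) y else 0)
        = (\<Sum>(x, p)\<leftarrow>xs. p * pmf (g x) y)"
      if "finite A" "set (map fst xs) \<subseteq> A" for A
      using that by (induction xs) (auto simp: sum.distrib)
    then show ?thesis by simp
  qed
  finally show ?thesis .
qed

lemma map_pmf_of_list:
  assumes "pmf_of_list_wf xs"
  shows "map_pmf f (pmf_of_list xs) = pmf_of_list (map (apfst f) xs)"
proof (rule pmf_eqI)
  fix y
  have wf: "pmf_of_list_wf (map (apfst f) xs)"
    using assms by (simp add: pmf_of_list_wf_def o_def)
  have "pmf (map_pmf f (pmf_of_list xs)) y = (\<Sum>z\<leftarrow>xs. if f (fst z) = y then snd z else 0)"
    unfolding map_pmf_def pmf_bind_pmf_of_list[OF assms]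
    by (intro arg_cong[of _ _ sum_list] map_cong) (auto split: split_indicator)
  also have "\<dots> = pmf (pmf_of_list (map (apfst f) xs)) y"
    by (simp add: pmf_pmf_of_list[OF wf] sum_list_map_filter' o_def cong: if_cong)
  finally show "pmf (map_pmf f (pmf_of_list xs)) y = pmf (pmf_of_list (map (apfst f) xs)) y" .
qed

definition scale :: "nat \<Rightarrow> typed_partition \<Rightarrow> typed_partition" where
  "scale c = image_mset (apsnd ((*) c))"

lemma scale_simps [simp]:
  "scale c {#} = {#}"
  "scale c (add_mset (t, m) P) = add_mset (t, c * m) (scale c P)"
  "scale c (P + Q) = scale c P + scale c Q"
  by (simp_all add: scale_def)

text \<open>The transition probabilities do not depend on \<open>m\<close>, and every offspring size
  is a fixed multiple of \<open>m\<close>.\<close>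

lemma branch_scale: "branch (t, c * m) = map_pmf (scale c) (branch (t, m))"
  by (cases t) (simp_all add: map_pmf_of_list branch_wf mult.left_commute)

lemma step_scale: "step (scale c P) = map_pmf (scale c) (step P)"
proof (induction P)
  case empty
  show ?case by (simp add: step_empty)
next
  case (add p P)
  then show ?case
    by (cases p)
       (simp add: step_add_mset_conv branch_scale scale_def map_pmf_conv_image_mset)
qed

lemma steps_scale: "steps k (scale c P) = map_pmf (scale c) (steps k P)"
  by (induction k) (simp_all add: step_scale map_bind_pmf bind_map_pmf)

text \<open>This is \<open>D\<close> without its weight, so that it is a genuine distribution and
  can be convolved.\<close>

definition process_dist :: "nat \<Rightarrow> typed_partition \<Rightarrow> nat multiset pmf" where
  "process_dist k P = map_pmf (image_mset snd) (steps k P)"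

lemma process_dist_add: "process_dist k (P + Q) = conv (process_dist k P) (process_dist k Q)"
  by (simp add: process_dist_def steps_add map_pmf_conv_image_mset)

text \<open>The \<open>NO_MATCH\<close> guard keeps the simplifier from splitting a singleton
  forever.\<close>

lemma process_dist_add_mset:
  "NO_MATCH {#} P \<Longrightarrow> process_dist k (add_mset p P) = conv (process_dist k {#p#}) (process_dist k P)"
  using process_dist_add[of k "{#p#}" P] by simp

lemma process_dist_scale:
  "process_dist k {#(t, c * m)#} = map_pmf (image_mset ((*) c)) (process_dist k {#(t, m)#})"
proof -
  have "process_dist k {#(t, c * m)#} = map_pmf (image_mset snd) (steps k (scale c {#(t, m)#}))"
    by (simp add: process_dist_def)
  also have "\<dots> = map_pmf (image_mset ((*) c)) (process_dist k {#(t, m)#})"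
    unfolding steps_scale process_dist_def
    by (simp add: pmf.map_comp o_def scale_def multiset.map_comp)
  finally show ?thesis .
qed

lemma process_dist_Suc_single: "process_dist (Suc k) {#p#} = bind_pmf (branch p) (process_dist k)"
  by (simp add: process_dist_def steps_Suc_first step_single map_bind_pmf process_dist_def[abs_def]
      del: steps.simps)

text \<open>Conditioning on the first branching; \<open>process_dist_scale\<close> brings offspring
  of size 3 back to size 1. The even half of the group will turn out to obey the same
  recursion.\<close>

lemma pmf_process_dist_Suc_Ts:
  "pmf (process_dist (Suc k) {#(Ts, 1)#}) p =
     2/3 * pmf (map_pmf (image_mset ((*) 3)) (process_dist k {#(Ts, 1)#})) p +
     1/12 * pmf (conv (process_dist k {#(Ts, 1)#})
       (conv (process_dist k {#(Ts, 1)#}) (process_dist k {#(Ts, 1)#}))) p +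
     1/4 * pmf (conv (process_dist k {#(Tn, 1)#})
       (conv (process_dist k {#(Tn, 1)#}) (process_dist k {#(Ts, 1)#}))) p"
  using process_dist_scale[of k Ts 3 1]
  unfolding process_dist_Suc_single branch.simps pmf_bind_pmf_of_list[OF branch_wf(1)]
  by (simp add: process_dist_add_mset conv_ac)

lemma pmf_process_dist_Suc_Tn:
  "pmf (process_dist (Suc k) {#(Tn, 1)#}) p =
     1/2 * pmf (conv (process_dist k {#(Ts, 1)#}) (map_pmf (image_mset ((*) 2)) (process_dist k {#(Tn, 1)#}))) p +
     1/2 * pmf (conv (process_dist k {#(Tn, 1)#}) (map_pmf (image_mset ((*) 2)) (process_dist k {#(Ts, 1)#}))) p"
  using process_dist_scale[of k Ts 2 1] process_dist_scale[of k Tn 2 1]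
  unfolding process_dist_Suc_single branch.simps pmf_bind_pmf_of_list[OF branch_wf(2)]
  by (simp add: process_dist_add_mset conv_ac)

section \<open>Cycle types and first returns\<close>

text \<open>The cycle type on an arbitrary set, so that the blocks of words with a common first
  letter can be treated one by one.\<close>

definition orbit_type :: "('a \<Rightarrow> 'a) \<Rightarrow> 'a set \<Rightarrow> nat multiset" where
  "orbit_type \<sigma> S = image_mset card (mset_set (orbit \<sigma> ` S))"

lemma orbit_funpow:
  assumes "permutation \<sigma>"
  shows "orbit \<sigma> ((\<sigma> ^^ j) x) = orbit \<sigma> x"
  by (induction j) (simp_all add: permutation_orbit_step[OF assms])

lemma orbit_subset_invariant:
  assumes "\<sigma> ` S \<subseteq> S" "x \<in> S"
  shows "orbit \<sigma> x \<subseteq> S"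
proof
  fix y assume "y \<in> orbit \<sigma> x"
  then show "y \<in> S" using assms by induction auto
qed

text \<open>Invariance keeps every orbit inside its own part, so no orbit is shared between the two
  sets of orbits.\<close>

lemma orbit_type_Un:
  assumes "permutation \<sigma>" "finite S" "finite T" "S \<inter> T = {}" "\<sigma> ` S \<subseteq> S" "\<sigma> ` T \<subseteq> T"
  shows "orbit_type \<sigma> (S \<union> T) = orbit_type \<sigma> S + orbit_type \<sigma> T"
proof -
  have "orbit \<sigma> ` S \<inter> orbit \<sigma> ` T = {}"
  proof (rule ccontr)
    assume "orbit \<sigma> ` S \<inter> orbit \<sigma> ` T \<noteq> {}"
    then obtain s t where "s \<in> S" "t \<in> T" "orbit \<sigma> s = orbit \<sigma> t" by auto
    with orbit_subset_invariant[OF assms(5)] orbit_subset_invariant[OF assms(6)]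
    have "s \<in> S \<inter> T" using permutation_self_in_orbit[OF assms(1)] by blast
    with assms(4) show False by simp
  qed
  then show ?thesis
    using assms(2,3) by (simp add: orbit_type_def image_Un mset_set_Union)
qed

text \<open>First-return principle: if \<open>\<tau>\<close> is the \<open>k\<close>-th power of \<open>\<sigma>\<close> seen on a section \<open>g ` T\<close> which
  \<open>\<sigma>\<close> leaves for \<open>k - 1\<close> steps, every cycle of \<open>\<tau>\<close> is stretched by the factor \<open>k\<close>.\<close>

lemma orbit_type_first_return:
  assumes \<sigma>: "permutation \<sigma>" and \<tau>: "permutation \<tau>" and T: "finite T" "\<tau> ` T \<subseteq> T"
    and g: "inj_on g T" and k: "k > 0"
    and ret: "\<And>w. w \<in> T \<Longrightarrow> (\<sigma> ^^ k) (g w) = g (\<tau> w)"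
    and away: "\<And>j w. 0 < j \<Longrightarrow> j < k \<Longrightarrow> w \<in> T \<Longrightarrow> (\<sigma> ^^ j) (g w) \<notin> g ` T"
  shows "orbit_type \<sigma> (\<Union>j<k. (\<sigma> ^^ j) ` g ` T) = image_mset ((*) k) (orbit_type \<tau> T)"
proof -
  \<comment> \<open>\<open>\<Phi>\<close> turns a \<open>\<tau>\<close>-orbit \<open>A\<close> into
    the \<open>\<sigma>\<close>-orbit that meets the section in the image of
    \<open>A\<close>.\<close>
  define \<Phi> where "\<Phi> A = (\<Union>j<k. (\<sigma> ^^ j) ` g ` A)" for A
  have inj: "inj (\<sigma> ^^ j)" for j
    using permutation_bijective[OF \<sigma>] by (intro inj_fn) (rule bij_is_inj)
  have \<tau>T: "(\<tau> ^^ q) w \<in> T" if "w \<in> T" for q w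
    using that T(2) by (induction q) auto
  have retq: "(\<sigma> ^^ (k * q)) (g w) = g ((\<tau> ^^ q) w)" if "w \<in> T" for q w
  proof (induction q)
    case (Suc q)
    have "(\<sigma> ^^ (k * Suc q)) (g w) = (\<sigma> ^^ k) ((\<sigma> ^^ (k * q)) (g w))"
      by (simp add: funpow_add)
    then show ?case using Suc ret \<tau>T[OF that] by simp
  qed simp
  have orb: "orbit \<sigma> (g w) = \<Phi> (orbit \<tau> w)" if w: "w \<in> T" for w
  proof (intro equalityI subsetI)
    fix v assume "v \<in> orbit \<sigma> (g w)"
    then obtain m where m: "v = (\<sigma> ^^ m) (g w)"
      by (auto simp: orbit_altdef_permutation[OF \<sigma>])
    \<comment> \<open>Division of \<open>m\<close> by \<open>k\<close>: the quotient counts the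
      returns to the section, the remainder the steps since the last return.\<close>
    have "v = (\<sigma> ^^ (m mod k + k * (m div k))) (g w)" by (simp add: m)
    also have "\<dots> = (\<sigma> ^^ (m mod k)) (g ((\<tau> ^^ (m div k)) w))"
      unfolding funpow_add o_apply retq[OF w] ..
    finally show "v \<in> \<Phi> (orbit \<tau> w)"
      using k by (auto simp: \<Phi>_def orbit_altdef_permutation[OF \<tau>] intro!: bexI[of _ "m mod k"])
  next
    fix v assume "v \<in> \<Phi> (orbit \<tau> w)"
    then obtain j q where "v = (\<sigma> ^^ j) (g ((\<tau> ^^ q) w))"
      by (auto simp: \<Phi>_def orbit_altdef_permutation[OF \<tau>])
    then have "v = (\<sigma> ^^ (j + k * q)) (g w)" by (simp add: funpow_add retq[OF w])
    then show "v \<in> orbit \<sigma> (g w)" by (auto simp: orbit_altdef_permutation[OF \<sigma>])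
  qed
  have sub: "orbit \<tau> w \<subseteq> T" if "w \<in> T" for w
    using orbit_subset_invariant[OF T(2) that] .
  have card: "card (\<Phi> A) = k * card A" if A: "A \<subseteq> T" for A
  proof -
    \<comment> \<open>If two translates met, cancelling \<open>i\<close> steps would bring a point
      of the section back to it in fewer than \<open>k\<close> steps.\<close>
    have ne: "(\<sigma> ^^ i) (g u) \<noteq> (\<sigma> ^^ j) (g v)" if "i < j" "j < k" "u \<in> T" "v \<in> T" for i j u v
    proof
      assume eq: "(\<sigma> ^^ i) (g u) = (\<sigma> ^^ j) (g v)"
      have "(\<sigma> ^^ j) (g v) = (\<sigma> ^^ i) ((\<sigma> ^^ (j - i)) (g v))"
        using \<open>i < j\<close> by (simp flip: funpow_add o_apply[of "\<sigma> ^^ i"])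
      then have "g u = (\<sigma> ^^ (j - i)) (g v)" using eq injD[OF inj[of i]] by simp
      moreover have "j - i < k" using that by linarith
      ultimately show False using away[of "j - i" v] that by (metis imageI zero_less_diff)
    qed
    have "card (\<Phi> A) = (\<Sum>j<k. card ((\<sigma> ^^ j) ` g ` A))"
      unfolding \<Phi>_def
    proof (rule card_UN_disjoint)
      show "\<forall>i\<in>{..<k}. \<forall>j\<in>{..<k}. i \<noteq> j \<longrightarrow> (\<sigma> ^^ i) ` g ` A \<inter> (\<sigma> ^^ j) ` g ` A = {}"
      proof (intro ballI impI equals0I)
        fix i j x assume "i \<in> {..<k}" "j \<in> {..<k}" "i \<noteq> j" "x \<in> (\<sigma> ^^ i) ` g ` A \<inter> (\<sigma> ^^ j) ` g ` A"
        moreover from this obtain u v where "u \<in> A" "v \<in> A" "x = (\<sigma> ^^ i) (g u)" "x = (\<sigma> ^^ j) (g v)"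
          by (elim IntE imageE) simp
        ultimately show False
          using ne[of i j u v] ne[of j i v u] A by (cases i j rule: linorder_cases) auto
      qed
    qed (use finite_subset[OF A T(1)] in simp_all)
    also have "\<dots> = (\<Sum>j<k. card A)"
      using inj_on_subset[OF g A]
      by (intro sum.cong refl) (simp add: card_image inj_on_subset[OF inj])
    finally show ?thesis by simp
  qed
  have "orbit \<sigma> ` (\<Union>j<k. (\<sigma> ^^ j) ` g ` T) = orbit \<sigma> ` g ` T"
    using k by (simp add: image_UN image_image orbit_funpow[OF \<sigma>] lessThan_empty_iff)
  also have "\<dots> = \<Phi> ` orbit \<tau> ` T"
    unfolding image_image by (intro image_cong refl orb)
  finally have img: "orbit \<sigma> ` (\<Union>j<k. (\<sigma> ^^ j) ` g ` T) = \<Phi> ` orbit \<tau> ` T" .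
  \<comment> \<open>The section recovers \<open>A\<close> from \<open>\<Phi> A\<close>, so
    \<open>\<Phi>\<close> does not merge distinct orbits.\<close>
  have \<Phi>_int: "\<Phi> A \<inter> g ` T = g ` A" if A: "A \<subseteq> T" for A
  proof
    show "\<Phi> A \<inter> g ` T \<subseteq> g ` A"
    proof
      fix x assume x: "x \<in> \<Phi> A \<inter> g ` T"
      then obtain j w where jw: "j < k" "w \<in> A" "x = (\<sigma> ^^ j) (g w)" by (auto simp: \<Phi>_def)
      with away[of j w] x A have "j = 0" by (metis IntD2 gr0I subsetD)
      with jw show "x \<in> g ` A" by simp
    qed
    show "g ` A \<subseteq> \<Phi> A \<inter> g ` T"
    proof
      fix x assume "x \<in> g ` A"
      then have "x \<in> (\<sigma> ^^ 0) ` g ` A" "x \<in> g ` T" using A by auto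
      with k show "x \<in> \<Phi> A \<inter> g ` T" unfolding \<Phi>_def by blast
    qed
  qed
  have "inj_on \<Phi> (orbit \<tau> ` T)"
  proof (rule inj_onI)
    fix A B assume AB: "A \<in> orbit \<tau> ` T" "B \<in> orbit \<tau> ` T" "\<Phi> A = \<Phi> B"
    then have "A \<subseteq> T" "B \<subseteq> T" using sub by auto
    with AB(3) \<Phi>_int have "g ` A = g ` B" by metis
    with \<open>A \<subseteq> T\<close> \<open>B \<subseteq> T\<close> show "A = B" using inj_on_image_eq_iff[OF g] by blast
  qed
  then have "orbit_type \<sigma> (\<Union>j<k. (\<sigma> ^^ j) ` g ` T)
      = image_mset card (image_mset \<Phi> (mset_set (orbit \<tau> ` T)))"
    by (simp add: orbit_type_def img image_mset_mset_set)
  also have "\<dots> = image_mset (\<lambda>A. k * card A) (mset_set (orbit \<tau> ` T))"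
    unfolding multiset.map_comp
    by (rule image_mset_cong) (use T(1) sub card in auto)
  also have "\<dots> = image_mset ((*) k) (orbit_type \<tau> T)"
    by (simp add: orbit_type_def multiset.map_comp o_def)
  finally show ?thesis .
qed

section \<open>Tree automorphisms with sign constraints\<close>

lemma exhaust_three: "i = 0 \<or> i = 1 \<or> i = (2::3)"
proof (cases i rule: bit1_cases)
  case (of_int z)
  then have "z = 0 \<or> z = 1 \<or> z = 2" by auto
  with of_int show ?thesis by auto
qed

lemma all_three: "(\<forall>i::3. P i) \<longleftrightarrow> P 0 \<and> P 1 \<and> P 2"
proof (intro iffI allI)
  fix i :: 3 assume "P 0 \<and> P 1 \<and> P 2"
  then show "P i" using exhaust_three[of i] by (elim disjE) simp_all
qed simp

lemma UNIV_three: "(UNIV :: 3 set) = {0, 1, 2}"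
  using exhaust_three by auto

text \<open>The group S_3 as the affine maps \<open>k + i\<close> and \<open>k - i\<close> of the
  integers modulo 3. The reflections are the transpositions, so \<open>e\<close> is the sign, with
  \<open>True\<close> for odd.\<close>

definition rot :: "bool \<Rightarrow> 3 \<Rightarrow> 3 \<Rightarrow> 3" where
  "rot e k i = (if e then k - i else k + i)"

text \<open>The parameter of the inverse map: reflections are involutions, rotations are undone by
  the opposite rotation.\<close>

definition rot_inv :: "bool \<Rightarrow> 3 \<Rightarrow> 3" where
  "rot_inv e k = (if e then k else - k)"

lemma rot_comp: "rot e k \<circ> rot e' k' = rot (e \<noteq> e') (if e then k - k' else k + k')"
  by (auto simp: rot_def fun_eq_iff)

lemma rot_zero [simp]: "rot False 0 = id"
  by (simp add: rot_def fun_eq_iff)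

lemma rot_inverse [simp]: "rot e (rot_inv e k) (rot e k i) = i" "rot e k (rot e (rot_inv e k) i) = i"
  by (simp_all add: rot_def rot_inv_def)

lemma rot_eq_iff [simp]: "rot e k i = rot e k j \<longleftrightarrow> i = j"
  by (metis rot_inverse(1))

lemma cycle_eq_rot: "cycle_of_list [0, 1, 2] = rot False 1" "cycle_of_list [0, 1] = rot True 1"
  unfolding fun_eq_iff all_three by (simp_all add: rot_def)

text \<open>Exclusive or is multiplication of signs when \<open>True\<close> stands for odd.\<close>

definition xor3 :: "(3 \<Rightarrow> bool) \<Rightarrow> bool" where
  "xor3 \<epsilon> = (\<epsilon> 0 \<noteq> (\<epsilon> 1 \<noteq> \<epsilon> 2))"

lemma xor3_const: "xor3 (\<lambda>_. e) = e"
  by (simp add: xor3_def)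

lemma xor3_rot: "xor3 (\<lambda>i. \<epsilon> (rot e k i)) = xor3 \<epsilon>"
proof -
  \<comment> \<open>Values modulo 3 by which the simplifier recognizes the permuted arguments of
    \<open>\<epsilon>\<close>.\<close>
  have "- 1 = (2::3)" "- 2 = (1::3)" "1 - 2 = (2::3)" "3 = (0::3)" "4 = (1::3)" by simp_all
  note [simp] = this
  show ?thesis
    using exhaust_three[of k] by (cases e) (auto simp: xor3_def rot_def)
qed

lemma xor3_neq: "xor3 (\<lambda>i. \<epsilon> i \<noteq> \<delta> i) = (xor3 \<epsilon> \<noteq> xor3 \<delta>)"
  by (auto simp: xor3_def)

definition tri :: "'a \<Rightarrow> 'a \<Rightarrow> 'a \<Rightarrow> 3 \<Rightarrow> 'a" where
  "tri a b c i = (if i = 0 then a else if i = 1 then b else c)"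

lemma tri_simps [simp]: "tri a b c 0 = a" "tri a b c 1 = b" "tri a b c 2 = c"
  by (simp_all add: tri_def)

lemma tri_eta: "tri (f 0) (f 1) (f 2) = f"
  unfolding fun_eq_iff all_three by simp

section \<open>Wreath decomposition and the families \<open>F\<close>\<close>

definition W :: "nat \<Rightarrow> (3 \<Rightarrow> aut) \<Rightarrow> (3 \<Rightarrow> 3) \<Rightarrow> aut" where
  "W n f \<pi> = wr n (f 0) (f 1) (f 2) \<pi>"

lemma W_Nil [simp]: "W n f \<pi> [] = []"
  by (simp add: W_def)

lemma W_Cons [simp]: "W n f \<pi> (i # w) = (if length w < n then \<pi> i # f i w else i # w)"
  using exhaust_three[of i] by (auto simp: W_def)

lemma wr_eq_W: "wr n a b c \<pi> = W n (tri a b c) \<pi>"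
  by (simp add: W_def)

text \<open>The product rule of the wreath recursion in composition order. Since \<open>f\<close>
  preserves lengths, both factors take the same branch of the truncation test.\<close>

lemma W_comp:
  assumes "\<And>i w. length (f i w) = length w"
  shows "W n g \<rho> \<circ> W n f \<pi> = W n (\<lambda>i. g (\<pi> i) \<circ> f i) (\<rho> \<circ> \<pi>)"
proof
  fix w show "(W n g \<rho> \<circ> W n f \<pi>) w = W n (\<lambda>i. g (\<pi> i) \<circ> f i) (\<rho> \<circ> \<pi>) w"
    by (cases w) (auto simp: assms)
qed

lemma W_id [simp]: "W n (\<lambda>_. id) id = id"
proof
  fix w show "W n (\<lambda>_. id) id w = id w" by (cases w) auto
qed

text \<open>\<open>F n False\<close> turns out to be \<open>L\<^sub>n\<close> and \<open>F n True\<close> its coset \<open>L\<^sub>n y\<^sub>n\<close>: at every vertex the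
  sign of the permutation of the children is the product of the signs at the three children,
  and the Boolean is the sign at the root (\<open>True\<close> being odd).\<close>

fun F :: "nat \<Rightarrow> bool \<Rightarrow> aut set" where
  "F 0 e = {id}"
| "F (Suc n) e = {W (Suc n) f (rot e k) | f k. \<exists>\<epsilon>. xor3 \<epsilon> = e \<and> (\<forall>i. f i \<in> F n (\<epsilon> i))}"

text \<open>No relation between \<open>\<epsilon>\<close> and \<open>e\<close> is imposed here; a
  cell is placed inside \<open>F (Suc n) e\<close> by the condition
  \<open>xor3 \<epsilon> = e\<close>.\<close>

definition cell :: "nat \<Rightarrow> (3 \<Rightarrow> bool) \<Rightarrow> bool \<Rightarrow> 3 \<Rightarrow> aut set" where
  "cell n \<epsilon> e k = {W (Suc n) f (rot e k) | f. \<forall>i. f i \<in> F n (\<epsilon> i)}"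

lemma F_Suc: "F (Suc n) e = (\<Union>k. \<Union>\<epsilon>\<in>{\<epsilon>. xor3 \<epsilon> = e}. cell n \<epsilon> e k)"
  by (auto simp: cell_def)

declare F.simps(2) [simp del]

lemma cellI: "(\<And>i. f i \<in> F n (\<epsilon> i)) \<Longrightarrow> W (Suc n) f (rot e k) \<in> cell n \<epsilon> e k"
  by (auto simp: cell_def)

lemma cell_subset_F: "xor3 \<epsilon> = e \<Longrightarrow> cell n \<epsilon> e k \<subseteq> F (Suc n) e"
  by (auto simp: F_Suc)

lemma length_F: "a \<in> F n e \<Longrightarrow> length (a w) = length w"
proof (induction n arbitrary: a e w)
  case (Suc n)
  then obtain f k \<epsilon> where a: "a = W (Suc n) f (rot e k)" "\<And>i. f i \<in> F n (\<epsilon> i)"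
    unfolding F.simps by blast
  show ?case using Suc.IH[OF a(2)] by (cases w) (simp_all add: a(1))
qed simp

lemma F_fixes_long: "a \<in> F n e \<Longrightarrow> length w > n \<Longrightarrow> a w = w"
proof (induction n arbitrary: a e w)
  case (Suc n)
  then show ?case by (cases w) (auto simp: F.simps)
qed simp

text \<open>Signs multiply componentwise once the first factor has permuted the letters.
  Multiplicativity one level below is a premise, so the lemma serves inside the induction for
  \<open>F_mult\<close> and, as \<open>cell_mult'\<close>, after it.\<close>

lemma cell_mult:
  assumes "a \<in> cell n \<epsilon> e k" "b \<in> cell n \<delta> e' k'"
    and mult: "\<And>a b e e'. a \<in> F n e \<Longrightarrow> b \<in> F n e' \<Longrightarrow> b \<circ> a \<in> F n (e \<noteq> e')"
  shows "b \<circ> a \<in> cell n (\<lambda>i. \<epsilon> i \<noteq> \<delta> (rot e k i)) (e' \<noteq> e) (if e' then k' - k else k' + k)"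
proof -
  obtain f g where f: "a = W (Suc n) f (rot e k)" "\<And>i. f i \<in> F n (\<epsilon> i)"
    and g: "b = W (Suc n) g (rot e' k')" "\<And>i. g i \<in> F n (\<delta> i)"
    using assms by (auto simp: cell_def)
  have "b \<circ> a = W (Suc n) (\<lambda>i. g (rot e k i) \<circ> f i) (rot (e' \<noteq> e) (if e' then k' - k else k' + k))"
    unfolding f g by (subst W_comp) (auto simp: rot_comp length_F[OF f(2)])
  then show ?thesis by (simp only:) (intro cellI mult f g)
qed

lemma F_mult: "a \<in> F n e \<Longrightarrow> b \<in> F n e' \<Longrightarrow> b \<circ> a \<in> F n (e \<noteq> e')"
proof (induction n arbitrary: a b e e')
  case (Suc n)
  then obtain \<epsilon> k \<delta> k' where "a \<in> cell n \<epsilon> e k" "b \<in> cell n \<delta> e' k'" "xor3 \<epsilon> = e" "xor3 \<delta> = e'"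
    unfolding F_Suc by auto
  note * = this
  have "xor3 (\<lambda>i. \<epsilon> i \<noteq> \<delta> (rot e k i)) = (e' \<noteq> e)"
    unfolding xor3_neq xor3_rot *(3,4) by (rule neq_commute)
  from subsetD[OF cell_subset_F[OF this] cell_mult[OF *(1,2) Suc.IH]]
  have "b \<circ> a \<in> F (Suc n) (e' \<noteq> e)" .
  then show ?case by (subst neq_commute)
qed (simp only: F.simps singleton_iff comp_id)

lemmas cell_mult' = cell_mult[OF _ _ F_mult]

text \<open>At each letter the inverse carries the inverse of the component at the preimage of that
  letter, so the signs are reindexed by the inverse permutation. As in \<open>cell_mult\<close>, the
  lower level enters as a premise.\<close>

lemma cell_inv:
  assumes "a \<in> cell n \<epsilon> e k"
    and inv: "\<And>a e. a \<in> F n e \<Longrightarrow> \<exists>b\<in>F n e. b \<circ> a = id \<and> a \<circ> b = id"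
  shows "\<exists>b\<in>cell n (\<lambda>i. \<epsilon> (rot e (rot_inv e k) i)) e (rot_inv e k). b \<circ> a = id \<and> a \<circ> b = id"
proof -
  obtain f where f: "a = W (Suc n) f (rot e k)" "\<And>i. f i \<in> F n (\<epsilon> i)"
    using assms by (auto simp: cell_def)
  define k' where "k' = rot_inv e k"
  have "\<forall>i. \<exists>b. b \<in> F n (\<epsilon> i) \<and> b \<circ> f i = id \<and> f i \<circ> b = id" using inv[OF f(2)] by blast
  then obtain g where g: "\<And>i. g i \<in> F n (\<epsilon> i)" "\<And>i. g i \<circ> f i = id" "\<And>i. f i \<circ> g i = id"
    unfolding choice_iff by blast
  define b where "b = W (Suc n) (\<lambda>i. g (rot e k' i)) (rot e k')"
  have rr: "rot e k' \<circ> rot e k = id" "rot e k \<circ> rot e k' = id"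
    by (simp_all add: fun_eq_iff k'_def)
  have "b \<circ> a = id" "a \<circ> b = id"
    unfolding b_def f(1)
    by (subst W_comp; simp add: length_F[OF f(2)] length_F[OF g(1)] rr g rr[unfolded fun_eq_iff o_apply])+
  moreover have "b \<in> cell n (\<lambda>i. \<epsilon> (rot e k' i)) e k'"
    unfolding b_def by (intro cellI g)
  ultimately show ?thesis unfolding k'_def by blast
qed

lemma F_inv: "a \<in> F n e \<Longrightarrow> \<exists>b\<in>F n e. b \<circ> a = id \<and> a \<circ> b = id"
proof (induction n arbitrary: a e)
  case (Suc n)
  then obtain \<epsilon> k where *: "a \<in> cell n \<epsilon> e k" "xor3 \<epsilon> = e" unfolding F_Suc by auto
  from cell_inv[OF *(1) Suc.IH] show ?case
    using cell_subset_F[of "\<lambda>i. \<epsilon> (rot e (rot_inv e k) i)" e n "rot_inv e k", unfolded xor3_rot, OF *(2)]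
    by blast
qed simp

lemmas cell_inv' = cell_inv[OF _ F_inv]

lemma id_in_F: "id \<in> F n False"
proof (induction n)
  case (Suc n)
  have "W (Suc n) (\<lambda>_. id) (rot False 0) \<in> cell n (\<lambda>_. False) False 0" by (intro cellI Suc)
  then show ?case
    unfolding rot_zero W_id using cell_subset_F[of "\<lambda>_. False" False n 0, OF xor3_const] by blast
qed (unfold F.simps, rule singletonI)

lemma bij_F: "a \<in> F n e \<Longrightarrow> bij a"
  by (drule F_inv) (auto intro: o_bij)

lemma F_child: "a \<in> F n e \<Longrightarrow> length v \<le> n \<Longrightarrow> length w \<le> n \<Longrightarrow> child (a v) (a w) \<longleftrightarrow> child v w"
proof (induction n arbitrary: a e v w)
  case (Suc n)
  then obtain f k \<epsilon> where a: "a = W (Suc n) f (rot e k)" "\<And>i. f i \<in> F n (\<epsilon> i)"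
    unfolding F.simps by blast
  have child_Nil: "child [] u \<longleftrightarrow> length u = 1" for u
    by (auto simp: child_def length_Suc_conv)
  show ?case
  proof (cases v)
    case Nil
    then show ?thesis using length_F[OF Suc.prems(1), of w] by (simp add: child_Nil a(1))
  next
    case (Cons i v')
    have no: "\<not> child (j # u) []" for j u by (simp add: child_def)
    have cc: "child (j # u) (j' # u') \<longleftrightarrow> j = j' \<and> child u u'" for j j' u u'
      by (auto simp: child_def)
    show ?thesis
      using Suc.prems Cons Suc.IH[OF a(2)] by (cases w) (auto simp: a(1) no cc)
  qed
qed (simp add: child_def)

lemma F_permutes:
  assumes "a \<in> F n e"
  shows "a permutes verts n"
proof -
  have "a w = w" if "w \<notin> verts n" for w
    using that by (intro F_fixes_long[OF assms]) (simp add: verts_def)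
  then show ?thesis
    unfolding permutes_def using bij_F[OF assms, unfolded bij_iff] by blast
qed

lemma F_carrier: "F n e \<subseteq> carrier (AutT n)"
proof
  fix a assume a: "a \<in> F n e"
  have "a [] = []" using length_F[OF a, of "[]"] by simp
  with F_permutes[OF a] F_child[OF a] show "a \<in> carrier (AutT n)"
    by (simp add: AutT_def verts_def)
qed

lemma finite_verts: "finite (verts n)"
  using finite_lists_length_le[of "UNIV :: 3 set" n] by (simp add: verts_def)

lemma finite_level: "finite (level n)"
  by (rule finite_subset[OF _ finite_verts[of n]]) (auto simp: level_def verts_def)

lemma F_permutation: "a \<in> F n e \<Longrightarrow> permutation a"
  by (rule permutation_permutes[THEN iffD2], intro exI conjI, rule finite_verts, rule F_permutes)

lemma F_level: "a \<in> F n e \<Longrightarrow> a ` level m \<subseteq> level m"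
  by (auto simp: level_def length_F)

lemma finite_F: "finite (F n e)"
  by (rule finite_subset[OF _ finite_permutations[OF finite_verts[of n]]]) (blast intro: F_permutes)

section \<open>The group of tree automorphisms and the generators\<close>

lemma AutT_simps [simp]: "mult (AutT n) = (\<lambda>\<sigma> \<tau>. \<tau> \<circ> \<sigma>)" "one (AutT n) = id"
  by (simp_all add: AutT_def)

text \<open>The equivalence is turned round so that it simplifies images to arguments.\<close>

lemma carrier_AutT_iff:
  "\<sigma> \<in> carrier (AutT n) \<longleftrightarrow> \<sigma> permutes verts n \<and> \<sigma> [] = [] \<and>
     (\<forall>v\<in>verts n. \<forall>w\<in>verts n. child (\<sigma> v) (\<sigma> w) \<longleftrightarrow> child v w)"
  unfolding AutT_def by (auto simp only: partial_object.simps mem_Collect_eq)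

lemma group_AutT: "group (AutT n)"
proof (rule groupI)
  fix x y assume xy: "x \<in> carrier (AutT n)" "y \<in> carrier (AutT n)"
  then have "x permutes verts n" "y permutes verts n" by (simp_all add: carrier_AutT_iff)
  with xy show "x \<otimes>\<^bsub>AutT n\<^esub> y \<in> carrier (AutT n)"
    using permutes_in_image[of x "verts n"] by (simp add: carrier_AutT_iff permutes_compose)
next
  fix x assume x: "x \<in> carrier (AutT n)"
  then have px: "x permutes verts n" by (simp add: carrier_AutT_iff)
  have "child (inv_into UNIV x v) (inv_into UNIV x w) \<longleftrightarrow> child v w" if "v \<in> verts n" "w \<in> verts n" for v w
  proof -
    have "inv_into UNIV x v \<in> verts n" "inv_into UNIV x w \<in> verts n"
      using that permutes_in_image[OF permutes_inv[OF px]] by auto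
    with x have "child (x (inv_into UNIV x v)) (x (inv_into UNIV x w)) \<longleftrightarrow>
        child (inv_into UNIV x v) (inv_into UNIV x w)"
      by (simp only: carrier_AutT_iff)
    then show ?thesis by (simp only: permutes_inverses[OF px])
  qed
  moreover have "inv_into UNIV x [] = []"
    using x permutes_inverses(2)[OF px, of "[]"] by (simp add: carrier_AutT_iff)
  ultimately have "inv_into UNIV x \<in> carrier (AutT n)"
    using permutes_inv[OF px] by (simp add: carrier_AutT_iff)
  moreover have "inv_into UNIV x \<otimes>\<^bsub>AutT n\<^esub> x = \<one>\<^bsub>AutT n\<^esub>"
    using permutes_inv_o(1)[OF px] by simp
  ultimately show "\<exists>y\<in>carrier (AutT n). y \<otimes>\<^bsub>AutT n\<^esub> x = \<one>\<^bsub>AutT n\<^esub>" by blast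
qed (simp_all add: comp_assoc carrier_AutT_iff permutes_id)

text \<open>The filler at index 0 is the identity, so one recursion covers level 1 as well. The same
  holds for \<open>yg_Suc\<close> and \<open>zg_Suc\<close>.\<close>

lemma xg_Suc: "xg (Suc n) = W (Suc n) (tri id id (xg n)) (rot False 1)"
  by (cases n) (simp_all only: xg.simps wr_eq_W cycle_eq_rot One_nat_def)

lemma yg_Suc: "yg (Suc n) = W (Suc n) (tri id (yg n) (xg n)) (rot True 1)"
  by (cases n) (simp_all only: xg.simps yg.simps wr_eq_W cycle_eq_rot One_nat_def)

lemma zg_Suc: "zg (Suc n) = W (Suc n) (tri (yg n) (yg n) (xg n)) id"
proof (cases n)
  case 0
  have "tri id id id = (\<lambda>_. id :: aut)" unfolding fun_eq_iff all_three by simp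
  then show ?thesis using 0 by (simp only: zg.simps yg.simps xg.simps W_id)
qed (simp only: xg.simps yg.simps zg.simps wr_eq_W)

lemma xg_cell_F: "xg n \<in> F n False" "xg (Suc n) \<in> cell n (\<lambda>_. False) False 1"
proof -
  have step: "xg (Suc n) \<in> cell n (\<lambda>_. False) False 1" if "xg n \<in> F n False" for n
  proof -
    have "\<forall>i. tri id id (xg n) i \<in> F n False"
      unfolding all_three using that id_in_F by simp
    then show ?thesis unfolding xg_Suc by (intro cellI) blast
  qed
  have F: "xg n \<in> F n False" for n
  proof (induction n)
    case (Suc n)
    show ?case by (rule subsetD[OF cell_subset_F[OF xor3_const] step[OF Suc]])
  qed (simp add: id_def)
  show "xg n \<in> F n False" "xg (Suc n) \<in> cell n (\<lambda>_. False) False 1"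
    by (intro F step)+
qed

lemma yg_F: "yg n \<in> F n True"
proof (induction n)
  case (Suc n)
  \<comment> \<open>Exactly one component is odd, which matches the odd transposition at the
    root.\<close>
  have "\<forall>i. tri id (yg n) (xg n) i \<in> F n (tri False True False i)"
    unfolding all_three using Suc id_in_F xg_cell_F(1) by simp
  then have "yg (Suc n) \<in> cell n (tri False True False) True 1"
    unfolding yg_Suc by (intro cellI) blast
  then show ?case using cell_subset_F[of "tri False True False" True n 1]
    by (auto simp: xor3_def)
qed (simp add: id_def)

lemma zg_cell: "zg (Suc n) \<in> cell n (tri True True False) False 0"
proof -
  have "\<forall>i. tri (yg n) (yg n) (xg n) i \<in> F n (tri True True False i)"
    unfolding all_three using yg_F xg_cell_F(1) by simp
  then show ?thesis
    unfolding zg_Suc rot_zero[symmetric] by (intro cellI) blast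
qed

lemma inv_AutT_comp:
  assumes "a \<in> carrier (AutT n)"
  shows "inv\<^bsub>AutT n\<^esub> a \<circ> a = id" "a \<circ> inv\<^bsub>AutT n\<^esub> a = id"
  using group.r_inv[OF group_AutT assms] group.l_inv[OF group_AutT assms] by simp_all

lemma inv_AutT_eq:
  assumes "a \<in> F n e" "b \<in> F n e'" "a \<circ> b = id"
  shows "inv\<^bsub>AutT n\<^esub> a = b"
  using assms F_carrier by (intro group.inv_equality[OF group_AutT]) auto

lemma inv_F:
  assumes "a \<in> F n e"
  shows "inv\<^bsub>AutT n\<^esub> a \<in> F n e"
  using F_inv[OF assms] inv_AutT_eq[OF assms] by metis

lemma inv_cell:
  assumes "a \<in> cell n \<epsilon> e k" "xor3 \<epsilon> = e"
  shows "inv\<^bsub>AutT (Suc n)\<^esub> a \<in> cell n (\<lambda>i. \<epsilon> (rot e (rot_inv e k) i)) e (rot_inv e k)"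
proof -
  obtain b where b: "b \<in> cell n (\<lambda>i. \<epsilon> (rot e (rot_inv e k) i)) e (rot_inv e k)" "a \<circ> b = id"
    using cell_inv'[OF assms(1)] by blast
  have "b \<in> F (Suc n) e"
    using b(1) cell_subset_F[of "\<lambda>i. \<epsilon> (rot e (rot_inv e k) i)" e] assms(2) by (auto simp: xor3_rot)
  moreover have "a \<in> F (Suc n) e" using assms cell_subset_F by blast
  ultimately show ?thesis using inv_AutT_eq b by metis
qed

lemma subgroup_F: "subgroup (F n False) (AutT n)"
proof (rule group.subgroupI[OF group_AutT])
  fix a b assume "a \<in> F n False" "b \<in> F n False"
  then show "a \<otimes>\<^bsub>AutT n\<^esub> b \<in> F n False" using F_mult[of a n False b False] by simp
qed (use F_carrier id_in_F inv_F in blast)+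

lemma subgroup_F_Un: "subgroup (F n False \<union> F n True) (AutT n)"
proof (rule group.subgroupI[OF group_AutT])
  fix a b assume "a \<in> F n False \<union> F n True" "b \<in> F n False \<union> F n True"
  then obtain e e' where "a \<in> F n e" "b \<in> F n e'" by blast
  then have "b \<circ> a \<in> F n (e \<noteq> e')" by (rule F_mult)
  then show "a \<otimes>\<^bsub>AutT n\<^esub> b \<in> F n False \<union> F n True"
    by (cases "e \<noteq> e'") auto
qed (use F_carrier id_in_F inv_F in blast)+

text \<open>\<open>even_cells n k\<close> is the coset \<open>K x\<^sup>k\<close> of the normal subgroup \<open>K = even_cells n 0\<close>.\<close>

definition even_cells :: "nat \<Rightarrow> 3 \<Rightarrow> aut set" where
  "even_cells n k = (\<Union>\<epsilon>\<in>{\<epsilon>. \<not> xor3 \<epsilon>}. cell n \<epsilon> False k)"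

lemma F_Suc_even_cells: "F (Suc n) False = (\<Union>k. even_cells n k)"
  by (auto simp: F_Suc even_cells_def)

text \<open>Products act from left to right, so a word with first letter \<open>i\<close> meets
  \<open>h\<close> at the letter \<open>k + i\<close>. The signs contributed by \<open>g\<close> and
  its inverse cancel, which leaves the rotated pattern of \<open>h\<close>.\<close>

lemma conj_cell:
  assumes "g \<in> cell n \<epsilon> False k" "\<not> xor3 \<epsilon>" "h \<in> cell n \<delta> False 0"
  shows "g \<otimes>\<^bsub>AutT (Suc n)\<^esub> h \<otimes>\<^bsub>AutT (Suc n)\<^esub> inv\<^bsub>AutT (Suc n)\<^esub> g \<in> cell n (\<lambda>i. \<delta> (k + i)) False 0"
proof -
  let ?g' = "inv\<^bsub>AutT (Suc n)\<^esub> g"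
  have "?g' \<in> cell n (\<lambda>i. \<epsilon> (rot False (- k) i)) False (- k)"
    using inv_cell[OF assms(1)] assms(2) by (simp add: rot_inv_def)
  note * = cell_mult'[OF cell_mult'[OF assms(1,3)] this]
  have "((p \<longleftrightarrow> \<not> q) \<longleftrightarrow> \<not> p) \<longleftrightarrow> q" for p q by blast
  with * show ?thesis by (simp add: rot_def)
qed

lemma cell_mult_even:
  assumes "a \<in> cell n \<epsilon> False k" "b \<in> cell n (\<lambda>_. False) False k'"
  shows "b \<circ> a \<in> cell n \<epsilon> False (k' + k)"
  using cell_mult'[OF assms] by simp

text \<open>The all-even cell changes no signs. Conversely the inverse of \<open>g\<close> has the
  same signs as \<open>g\<close>, since the permutation is the identity, and cancels those of any
  other element of the cell.\<close>

lemma coset_cell: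
  assumes g: "g \<in> cell n \<epsilon> False 0" "\<not> xor3 \<epsilon>"
  shows "g <#\<^bsub>AutT (Suc n)\<^esub> cell n (\<lambda>_. False) False 0 = cell n \<epsilon> False 0"
proof (intro equalityI subsetI)
  fix s assume "s \<in> g <#\<^bsub>AutT (Suc n)\<^esub> cell n (\<lambda>_. False) False 0"
  then obtain h where "h \<in> cell n (\<lambda>_. False) False 0" "s = h \<circ> g"
    by (auto simp: l_coset_def)
  with cell_mult_even[OF g(1)] show "s \<in> cell n \<epsilon> False 0" by force
next
  fix s assume s: "s \<in> cell n \<epsilon> False 0"
  let ?g' = "inv\<^bsub>AutT (Suc n)\<^esub> g"
  have "?g' \<in> cell n \<epsilon> False 0"
    using inv_cell[OF g(1)] g(2) by (simp add: rot_inv_def)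
  from cell_mult'[OF this s] have "s \<circ> ?g' \<in> cell n (\<lambda>_. False) False 0"
    by simp
  moreover have "g \<in> carrier (AutT (Suc n))"
    using g cell_subset_F[of \<epsilon> False] F_carrier by blast
  then have "s = (s \<circ> ?g') \<circ> g"
    using inv_AutT_comp(1)[of g "Suc n"] by (simp add: comp_assoc)
  ultimately show "s \<in> g <#\<^bsub>AutT (Suc n)\<^esub> cell n (\<lambda>_. False) False 0"
    unfolding l_coset_def by auto
qed

text \<open>Multiplication by \<open>g\<close> keeps all signs and only adds to the rotation. This
  describes the cosets of \<open>K\<close> and also reaches all of \<open>F (Suc n) False\<close>
  from \<open>even_cells n 0\<close>.\<close>

lemma even_cells_shift:
  assumes g: "g \<in> cell n (\<lambda>_. False) False k"
  shows "even_cells n (k + l) = (\<lambda>a. g \<circ> a) ` even_cells n l"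
proof (intro equalityI subsetI)
  fix s assume "s \<in> even_cells n (k + l)"
  then obtain \<epsilon> where \<epsilon>: "\<not> xor3 \<epsilon>" "s \<in> cell n \<epsilon> False (k + l)"
    by (auto simp: even_cells_def)
  let ?g' = "inv\<^bsub>AutT (Suc n)\<^esub> g"
  have "?g' \<in> cell n (\<lambda>_. False) False (- k)"
    using inv_cell[OF g] by (simp add: rot_inv_def xor3_const)
  from cell_mult_even[OF \<epsilon>(2) this] \<epsilon>(1) have "?g' \<circ> s \<in> even_cells n l"
    by (auto simp: even_cells_def)
  moreover have "g \<in> carrier (AutT (Suc n))"
    using g cell_subset_F[OF xor3_const] F_carrier by blast
  then have "s = g \<circ> (?g' \<circ> s)"
    using inv_AutT_comp(2)[of g "Suc n"] by (simp flip: comp_assoc)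
  ultimately show "s \<in> (\<lambda>a. g \<circ> a) ` even_cells n l" by blast
next
  fix s assume "s \<in> (\<lambda>a. g \<circ> a) ` even_cells n l"
  then show "s \<in> even_cells n (k + l)"
    using cell_mult_even[OF _ g] by (force simp: even_cells_def)
qed

section \<open>Generating the cells from \<open>x\<close>, \<open>z\<close> and the embedded
  copy\<close>

definition coord :: "nat \<Rightarrow> 3 \<Rightarrow> aut \<Rightarrow> aut" where
  "coord n i a = W n ((\<lambda>_. id)(i := a)) id"

lemma emb_eq_coord: "emb n a = coord n 0 a"
proof -
  have "tri a id id = (\<lambda>_. id)(0 := a)" unfolding fun_eq_iff all_three by simp
  then show ?thesis by (simp add: emb_def wr_eq_W coord_def)
qed

text \<open>Conjugation by \<open>x\<close> carries the embedded copy at coordinate 0 to the other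
  coordinates, and the three copies multiply to the whole cell. The premises are phrased to fit both
  subgroups containing \<open>x\<close> and normal subgroups of \<open>L\<close>.\<close>

lemma cell_zero_subset:
  assumes N: "\<And>a b. a \<in> N \<Longrightarrow> b \<in> N \<Longrightarrow> b \<circ> a \<in> N"
    and emb: "emb (Suc n) ` F n False \<subseteq> N"
    and conj: "\<And>h. h \<in> N \<Longrightarrow>
      xg (Suc n) \<otimes>\<^bsub>AutT (Suc n)\<^esub> h \<otimes>\<^bsub>AutT (Suc n)\<^esub> inv\<^bsub>AutT (Suc n)\<^esub> (xg (Suc n)) \<in> N"
  shows "cell n (\<lambda>_. False) False 0 \<subseteq> N"
proof -
  let ?x = "xg (Suc n)" and ?G = "AutT (Suc n)"
  have x: "?x \<in> carrier ?G" using xg_cell_F(1) F_carrier by blast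
  obtain f where f: "?x = W (Suc n) f (rot False 1)" "\<And>i. f i \<in> F n False"
    using xg_cell_F(2)[of n] by (auto simp: cell_def)
  have step: "coord (Suc n) i a \<in> N"
    if a: "a \<in> F n False" and IH: "\<And>b. b \<in> F n False \<Longrightarrow> coord (Suc n) (1 + i) b \<in> N" for i a
  proof -
    obtain c where c: "c \<in> F n False" "c \<circ> f i = id" using F_inv[OF f(2)] by blast
    \<comment> \<open>\<open>b\<close> is \<open>a\<close> conjugated by the component
      \<open>f i\<close> of \<open>x\<close>, the twist that arises when \<open>x\<close> moves
      coordinate \<open>i\<close> to \<open>1 + i\<close>.\<close>
    define b where "b = f i \<circ> (a \<circ> c)"
    have b: "b \<in> F n False"
      using F_mult[OF F_mult[OF c(1) a] f(2)] by (simp add: b_def)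
    have len: "length (((\<lambda>_. id)(i := a)) j w) = length w" for j w
      using length_F[OF a] by simp
    have "?x \<circ> coord (Suc n) i a = coord (Suc n) (1 + i) b \<circ> ?x"
    proof -
      have "f j \<circ> ((\<lambda>_. id)(i := a)) j = ((\<lambda>_. id)(1 + i := b)) (rot False 1 j) \<circ> f j" for j
        using c(2) by (simp add: rot_def b_def comp_assoc)
      then show ?thesis
        unfolding coord_def f(1) by (simp add: W_comp[OF len] W_comp[OF length_F[OF f(2)]] del: fun_upd_apply)
    qed
    then have "inv\<^bsub>?G\<^esub> ?x \<circ> (coord (Suc n) (1 + i) b \<circ> ?x) = coord (Suc n) i a"
      using inv_AutT_comp(1)[OF x] by (metis comp_assoc comp_id id_comp)
    with conj[OF IH[OF b]] show ?thesis by simp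
  qed
  have s0: "coord (Suc n) 0 a \<in> N" if "a \<in> F n False" for a
    using emb that by (auto simp: emb_eq_coord)
  \<comment> \<open>\<open>step\<close> lowers the coordinate by one modulo 3, so coordinate 2 is
    reached from 0, and then 1 from 2.\<close>
  have "1 + 2 = (0::3)" by simp
  then have s2: "coord (Suc n) 2 a \<in> N" if "a \<in> F n False" for a
    by (intro step[OF that]) (simp only: s0)
  have s1: "coord (Suc n) 1 a \<in> N" if "a \<in> F n False" for a
    by (rule step[OF that]) (simp add: s2)
  show ?thesis
  proof
    fix s assume "s \<in> cell n (\<lambda>_. False) False 0"
    then obtain g where g: "s = W (Suc n) g id" "\<And>i. g i \<in> F n False" by (auto simp: cell_def)
    have len: "length (((\<lambda>_. id)(i := g i)) j w) = length w" for i j w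
      using length_F[OF g(2)] by simp
    have len': "length ((((\<lambda>_. id)(i := g i)) j \<circ> ((\<lambda>_. id)(i' := g i')) j) w) = length w" for i i' j w
      using length_F[OF g(2)] by simp
    have "coord (Suc n) 2 (g 2) \<circ> (coord (Suc n) 1 (g 1) \<circ> coord (Suc n) 0 (g 0)) =
        W (Suc n) (\<lambda>j. ((\<lambda>_. id)(2 := g 2)) j \<circ> (((\<lambda>_. id)(1 := g 1)) j \<circ> ((\<lambda>_. id)(0 := g 0)) j)) id"
      unfolding coord_def
      by (simp add: W_comp[OF len] W_comp[OF len'] del: fun_upd_apply)
         (simp add: o_def del: fun_upd_apply)
    also have "(\<lambda>j. ((\<lambda>_. id)(2 := g 2)) j \<circ> (((\<lambda>_. id)(1 := g 1)) j \<circ> ((\<lambda>_. id)(0 := g 0)) j)) = g"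
      unfolding fun_eq_iff[of _ g] all_three by simp
    finally have "coord (Suc n) 2 (g 2) \<circ> (coord (Suc n) 1 (g 1) \<circ> coord (Suc n) 0 (g 0)) = s"
      unfolding g(1) .
    with N[OF N[OF s0[OF g(2)[of 0]] s1[OF g(2)[of 1]]] s2[OF g(2)[of 2]]] show "s \<in> N" by (simp only:)
  qed
qed

text \<open>\<open>z\<close> and its conjugates by \<open>x\<close> and its square have the three
  sign patterns with exactly two odd components. With the all-even pattern these exhaust the even
  patterns, and one element of a cell yields the whole cell by \<open>coset_cell\<close>.\<close>

lemma even_cells_subset:
  assumes N: "subgroup N (AutT (Suc n))"
    and emb: "emb (Suc n) ` F n False \<subseteq> N"
    and conj: "\<And>h. h \<in> N \<Longrightarrow>
      xg (Suc n) \<otimes>\<^bsub>AutT (Suc n)\<^esub> h \<otimes>\<^bsub>AutT (Suc n)\<^esub> inv\<^bsub>AutT (Suc n)\<^esub> (xg (Suc n)) \<in> N"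
    and z: "zg (Suc n) \<in> N"
  shows "even_cells n 0 \<subseteq> N"
proof -
  let ?x = "xg (Suc n)" and ?G = "AutT (Suc n)"
  have mult: "b \<circ> a \<in> N" if "a \<in> N" "b \<in> N" for a b
    using subgroup.m_closed[OF N that] by simp
  have zero: "cell n (\<lambda>_. False) False 0 \<subseteq> N"
    by (rule cell_zero_subset[OF mult emb conj])
  have coset: "cell n \<epsilon> False 0 \<subseteq> N" if "g \<in> cell n \<epsilon> False 0" "g \<in> N" "\<not> xor3 \<epsilon>" for g \<epsilon>
    unfolding coset_cell[OF that(1,3), symmetric] l_coset_def using zero mult[OF that(2)] by auto
  define z1 where "z1 = ?x \<otimes>\<^bsub>?G\<^esub> zg (Suc n) \<otimes>\<^bsub>?G\<^esub> inv\<^bsub>?G\<^esub> ?x"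
  define z2 where "z2 = ?x \<otimes>\<^bsub>?G\<^esub> z1 \<otimes>\<^bsub>?G\<^esub> inv\<^bsub>?G\<^esub> ?x"
  have N12: "z1 \<in> N" "z2 \<in> N" unfolding z2_def z1_def by (intro conj z)+
  have v1: "(\<lambda>i. tri True True False (1 + i)) = tri True False True"
    and v2: "(\<lambda>i. tri True False True (1 + i)) = tri False True True"
    unfolding fun_eq_iff all_three by (simp_all add: tri_def)
  have not_xor: "\<not> xor3 (\<lambda>_. False)" by (simp add: xor3_const)
  have z1: "z1 \<in> cell n (tri True False True) False 0"
    using conj_cell[OF xg_cell_F(2) not_xor zg_cell] unfolding z1_def v1 .
  have z2: "z2 \<in> cell n (tri False True True) False 0"
    using conj_cell[OF xg_cell_F(2) not_xor z1] unfolding z2_def v2 .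
  show ?thesis
  proof
    fix s assume "s \<in> even_cells n 0"
    then obtain \<epsilon> where \<epsilon>: "\<not> xor3 \<epsilon>" "s \<in> cell n \<epsilon> False 0" by (auto simp: even_cells_def)
    have "\<epsilon> = (\<lambda>_. False) \<or> \<epsilon> = tri True True False \<or> \<epsilon> = tri True False True \<or> \<epsilon> = tri False True True"
      using \<epsilon>(1) unfolding fun_eq_iff all_three xor3_def by auto
    with \<epsilon> show "s \<in> N"
      using zero coset[OF zg_cell z] coset[OF z1 N12(1)] coset[OF z2 N12(2)] by blast
  qed
qed

section \<open>Identification of \<open>Lg\<close> and \<open>Mg\<close>\<close>

lemma zg_F: "zg (Suc n) \<in> F (Suc n) False"
  using zg_cell[of n] cell_subset_F[of "tri True True False" False n 0] by (auto simp: xor3_def)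

lemma emb_cell: "emb (Suc n) ` F n False \<subseteq> cell n (\<lambda>_. False) False 0"
proof
  fix s assume "s \<in> emb (Suc n) ` F n False"
  then obtain a where a: "a \<in> F n False" "s = coord (Suc n) 0 a" by (auto simp: emb_eq_coord)
  then show "s \<in> cell n (\<lambda>_. False) False 0"
    unfolding coord_def a(2) rot_zero[symmetric] by (intro cellI) (simp add: id_in_F)
qed

lemma cell_subset_even_cells: "\<not> xor3 \<epsilon> \<Longrightarrow> cell n \<epsilon> False k \<subseteq> even_cells n k"
  by (auto simp: even_cells_def)

lemma even_cells_subset_F: "even_cells n k \<subseteq> F (Suc n) False"
  by (auto simp: F_Suc_even_cells)

lemma emb_F: "emb (Suc n) ` F n False \<subseteq> F (Suc n) False"
  using emb_cell cell_subset_F[OF xor3_const] by blast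

text \<open>With \<open>x\<close> in \<open>N\<close>, closure under conjugation by \<open>x\<close>
  is automatic and gives the cells over the identity; multiplying by \<open>x\<close> reaches the
  other two rotations.\<close>

lemma F_False_subset:
  assumes N: "subgroup N (AutT (Suc n))"
    and emb: "emb (Suc n) ` F n False \<subseteq> N" and x: "xg (Suc n) \<in> N" and z: "zg (Suc n) \<in> N"
  shows "F (Suc n) False \<subseteq> N"
proof -
  let ?x = "xg (Suc n)" and ?G = "AutT (Suc n)"
  have c: "?x \<otimes>\<^bsub>?G\<^esub> h \<otimes>\<^bsub>?G\<^esub> inv\<^bsub>?G\<^esub> ?x \<in> N" if "h \<in> N" for h
    by (intro subgroup.m_closed[OF N] subgroup.m_inv_closed[OF N] x that)
  have E0: "even_cells n 0 \<subseteq> N" by (rule even_cells_subset[OF N emb c z])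
  have E: "even_cells n (1 + k) \<subseteq> N" if "even_cells n k \<subseteq> N" for k
    unfolding even_cells_shift[OF xg_cell_F(2)]
    using subgroup.m_closed[OF N _ x] that by auto
  have E1: "even_cells n 1 \<subseteq> N" using E[OF E0] by simp
  have E2: "even_cells n 2 \<subseteq> N" using E[OF E1] by simp
  show ?thesis unfolding F_Suc_even_cells UNIV_three using E0 E1 E2 by auto
qed

lemma Lg_eq_F: "n > 0 \<Longrightarrow> Lg n = F n False"
proof (induction n rule: Lg.induct)
  case 2
  have sub: "subgroup (generate (AutT 1) {xg 1}) (AutT 1)"
    using xg_cell_F(1)[of 1] F_carrier by (intro group.generate_is_subgroup[OF group_AutT]) blast
  \<comment> \<open>At level 1 the embedded copy is trivial and \<open>zg 1\<close> is the identity,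
    so \<open>xg 1\<close> alone meets the premises of \<open>F_False_subset\<close>.\<close>
  have "emb 1 ` F 0 False = {\<one>\<^bsub>AutT 1\<^esub>}"
    by (simp only: F.simps emb_eq_coord coord_def fun_upd_triv[of "\<lambda>_. id"] W_id
        AutT_simps image_insert image_empty)
  then have "F 1 False \<subseteq> generate (AutT 1) {xg 1}"
    using F_False_subset[OF sub[unfolded One_nat_def]] subgroup.one_closed[OF sub]
      generate.incl[of "xg 1" "{xg 1}" "AutT 1"] by simp
  moreover have "generate (AutT 1) {xg 1} \<subseteq> F 1 False"
    using xg_cell_F(1)[of 1] by (intro group.generate_subgroup_incl[OF group_AutT _ subgroup_F]) simp
  ultimately show ?case by simp
next
  case (3 n)
  let ?n = "Suc (Suc n)"
  let ?S = "{xg ?n, zg ?n} \<union> emb ?n ` F (Suc n) False"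
  have S: "?S \<subseteq> F ?n False"
    using xg_cell_F(1)[of ?n] zg_F[of "Suc n"] emb_F[of "Suc n"] by blast
  have "generate (AutT ?n) ?S \<subseteq> F ?n False"
    by (rule group.generate_subgroup_incl[OF group_AutT S subgroup_F])
  moreover have "subgroup (generate (AutT ?n) ?S) (AutT ?n)"
    using S F_carrier by (intro group.generate_is_subgroup[OF group_AutT]) blast
  then have "F ?n False \<subseteq> generate (AutT ?n) ?S"
    by (intro F_False_subset) (auto intro: generate.incl)
  ultimately show ?case using 3 by simp
qed simp

text \<open>\<open>yg n\<close> is odd, so its inverse carries odd elements to even ones.\<close>

lemma F_True_coset:
  "F n True = F n False #>\<^bsub>AutT n\<^esub> yg n"
proof (intro equalityI subsetI)
  fix s assume s: "s \<in> F n True"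
  let ?y' = "inv\<^bsub>AutT n\<^esub> (yg n)"
  have "?y' \<circ> s \<in> F n False" using F_mult[OF s inv_F[OF yg_F]] by simp
  moreover have "yg n \<in> carrier (AutT n)" using yg_F F_carrier by blast
  then have "s = yg n \<circ> (?y' \<circ> s)"
    using inv_AutT_comp(2)[of "yg n" n] by (simp flip: comp_assoc)
  ultimately show "s \<in> F n False #>\<^bsub>AutT n\<^esub> yg n" unfolding r_coset_def by auto
next
  fix s assume "s \<in> F n False #>\<^bsub>AutT n\<^esub> yg n"
  then show "s \<in> F n True"
    using F_mult[OF _ yg_F, of _ n False] by (auto simp: r_coset_def)
qed

text \<open>The generators shared with \<open>Lg\<close> give the even half, and the odd
  \<open>yg\<close> adds its coset. Level 1 has a definition of its own in \<open>Mg\<close>, hence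
  the two successors.\<close>

lemma Mg_eq_F: "Mg (Suc (Suc n)) = F (Suc (Suc n)) False \<union> F (Suc (Suc n)) True"
proof -
  let ?n = "Suc (Suc n)"
  let ?S = "{xg ?n, yg ?n, zg ?n} \<union> emb ?n ` F (Suc n) False"
  have S: "?S \<subseteq> F ?n False \<union> F ?n True"
    using xg_cell_F(1)[of ?n] yg_F[of ?n] zg_F[of "Suc n"] emb_F[of "Suc n"] by blast
  have gen: "subgroup (generate (AutT ?n) ?S) (AutT ?n)"
    using S F_carrier by (intro group.generate_is_subgroup[OF group_AutT]) blast
  have "generate (AutT ?n) ?S \<subseteq> F ?n False \<union> F ?n True"
    by (rule group.generate_subgroup_incl[OF group_AutT S subgroup_F_Un])
  moreover have F: "F ?n False \<subseteq> generate (AutT ?n) ?S"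
    by (intro F_False_subset gen) (auto intro: generate.incl)
  moreover have "F ?n True \<subseteq> generate (AutT ?n) ?S"
    unfolding F_True_coset r_coset_def
    using F subgroup.m_closed[OF gen _ generate.incl[of "yg ?n"]] by auto
  ultimately show ?thesis using Lg_eq_F[of "Suc n"] by (simp add: Un_commute) blast
qed

section \<open>Normal closures in \<open>L\<close>\<close>

lemma LG_eq: "LG (Suc n) = (AutT (Suc n))\<lparr>carrier := F (Suc n) False\<rparr>"
  by (simp add: LG_def Lg_eq_F)

lemma group_LG: "group (LG (Suc n))"
  unfolding LG_eq using subgroup.subgroup_is_group[OF subgroup_F group_AutT] .

lemma inv_LG: "a \<in> F (Suc n) False \<Longrightarrow> inv\<^bsub>LG (Suc n)\<^esub> a = inv\<^bsub>AutT (Suc n)\<^esub> a"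
  unfolding LG_eq using group.m_inv_consistent[OF group_AutT subgroup_F] by metis

text \<open>Expresses normality through products and inverses of \<open>AutT\<close>, in which the
  lemmas on cells are phrased.\<close>

lemma normal_LG_iff:
  "N \<lhd> LG (Suc n) \<longleftrightarrow> subgroup N (AutT (Suc n)) \<and> N \<subseteq> F (Suc n) False \<and>
    (\<forall>g\<in>F (Suc n) False. \<forall>h\<in>N.
       g \<otimes>\<^bsub>AutT (Suc n)\<^esub> h \<otimes>\<^bsub>AutT (Suc n)\<^esub> inv\<^bsub>AutT (Suc n)\<^esub> g \<in> N)"
proof -
  have "subgroup N (LG (Suc n)) \<longleftrightarrow> subgroup N (AutT (Suc n)) \<and> N \<subseteq> F (Suc n) False"
    unfolding LG_eq using group.subgroup_incl[OF group_AutT _ subgroup_F]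
      group.incl_subgroup[OF group_AutT subgroup_F] subgroup.subset by fastforce
  moreover have "carrier (LG (Suc n)) = F (Suc n) False" "mult (LG (Suc n)) = mult (AutT (Suc n))"
    by (simp_all add: LG_eq)
  ultimately show ?thesis
    unfolding group.normal_inv_iff[OF group_LG] by (simp add: inv_LG)
qed

lemma subgroup_cell_zero: "subgroup (cell n (\<lambda>_. False) False 0) (AutT (Suc n))"
proof (rule group.subgroupI[OF group_AutT])
  show "cell n (\<lambda>_. False) False 0 \<subseteq> carrier (AutT (Suc n))"
    using cell_subset_F[OF xor3_const] F_carrier by blast
  show "cell n (\<lambda>_. False) False 0 \<noteq> {}"
    using emb_cell id_in_F by blast
  fix a assume a: "a \<in> cell n (\<lambda>_. False) False 0"
  from inv_cell[OF a] show "inv\<^bsub>AutT (Suc n)\<^esub> a \<in> cell n (\<lambda>_. False) False 0"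
    by (simp add: xor3_const rot_inv_def)
  fix b assume "b \<in> cell n (\<lambda>_. False) False 0"
  from cell_mult_even[OF a this] show "a \<otimes>\<^bsub>AutT (Suc n)\<^esub> b \<in> cell n (\<lambda>_. False) False 0"
    by simp
qed

lemma subgroup_even_cells: "subgroup (even_cells n 0) (AutT (Suc n))"
proof (rule group.subgroupI[OF group_AutT])
  show "even_cells n 0 \<subseteq> carrier (AutT (Suc n))"
    using even_cells_subset_F F_carrier by blast
  show "even_cells n 0 \<noteq> {}"
    using zg_cell[of n] by (auto simp: even_cells_def xor3_def intro!: exI[of _ "tri True True False"])
  fix a assume "a \<in> even_cells n 0"
  then obtain \<epsilon> where a: "\<not> xor3 \<epsilon>" "a \<in> cell n \<epsilon> False 0" by (auto simp: even_cells_def)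
  from inv_cell[OF a(2)] a(1) show "inv\<^bsub>AutT (Suc n)\<^esub> a \<in> even_cells n 0"
    by (auto simp: rot_inv_def even_cells_def)
  fix b assume "b \<in> even_cells n 0"
  then obtain \<delta> where b: "\<not> xor3 \<delta>" "b \<in> cell n \<delta> False 0" by (auto simp: even_cells_def)
  from cell_mult'[OF a(2) b(2)] have "b \<circ> a \<in> cell n (\<lambda>i. \<epsilon> i \<noteq> \<delta> i) False 0"
    by simp
  moreover have "\<not> xor3 (\<lambda>i. \<epsilon> i \<noteq> \<delta> i)" unfolding xor3_neq using a(1) b(1) by simp
  ultimately show "a \<otimes>\<^bsub>AutT (Suc n)\<^esub> b \<in> even_cells n 0"
    using cell_subset_even_cells by auto
qed

text \<open>Conjugation only permutes the three signs, and the constant pattern is invariant. For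
  \<open>even_cells n 0\<close> below, the invariant is the product of the signs.\<close>

lemma normal_cell_zero: "cell n (\<lambda>_. False) False 0 \<lhd> LG (Suc n)"
  unfolding normal_LG_iff
proof (intro conjI ballI)
  show "cell n (\<lambda>_. False) False 0 \<subseteq> F (Suc n) False"
    by (rule cell_subset_F[OF xor3_const])
  fix g h assume "g \<in> F (Suc n) False" and h: "h \<in> cell n (\<lambda>_. False) False 0"
  then obtain \<epsilon> k where "g \<in> cell n \<epsilon> False k" "\<not> xor3 \<epsilon>" by (auto simp: F_Suc)
  from conj_cell[OF this h]
  show "g \<otimes>\<^bsub>AutT (Suc n)\<^esub> h \<otimes>\<^bsub>AutT (Suc n)\<^esub> inv\<^bsub>AutT (Suc n)\<^esub> g \<in> cell n (\<lambda>_. False) False 0" .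
qed (rule subgroup_cell_zero)

lemma normal_even_cells: "even_cells n 0 \<lhd> LG (Suc n)"
  unfolding normal_LG_iff
proof (intro conjI ballI)
  fix g h assume "g \<in> F (Suc n) False" and "h \<in> even_cells n 0"
  then obtain \<epsilon> k \<delta> where g: "g \<in> cell n \<epsilon> False k" "\<not> xor3 \<epsilon>" and h: "h \<in> cell n \<delta> False 0" "\<not> xor3 \<delta>"
    by (auto simp: F_Suc even_cells_def)
  have "\<not> xor3 (\<lambda>i. \<delta> (k + i))" using xor3_rot[of \<delta> False k] h(2) by (simp add: rot_def)
  with conj_cell[OF g h(1)] cell_subset_even_cells
  show "g \<otimes>\<^bsub>AutT (Suc n)\<^esub> h \<otimes>\<^bsub>AutT (Suc n)\<^esub> inv\<^bsub>AutT (Suc n)\<^esub> g \<in> even_cells n 0" by blast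
qed (rule subgroup_even_cells even_cells_subset_F)+

text \<open>The cell is normal and contains the embedded copy. Conversely every competing
  \<open>N\<close> is closed under conjugation by \<open>x\<close>, an element of \<open>L\<close>,
  so \<open>cell_zero_subset\<close> applies.\<close>

lemma Hg_eq_cell: "n > 0 \<Longrightarrow> Hg (Suc n) = cell n (\<lambda>_. False) False 0"
proof (intro equalityI)
  assume n: "n > 0"
  show "Hg (Suc n) \<subseteq> cell n (\<lambda>_. False) False 0"
    unfolding Hg_def normal_closure_def
    using normal_cell_zero emb_cell n by (auto simp: Lg_eq_F)
  show "cell n (\<lambda>_. False) False 0 \<subseteq> Hg (Suc n)"
    unfolding Hg_def normal_closure_def
  proof (rule Inter_greatest)
    fix N assume "N \<in> {N. N \<lhd> LG (Suc n) \<and> emb (Suc n) ` Lg (Suc n - 1) \<subseteq> N}"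
    then have N: "N \<lhd> LG (Suc n)" "emb (Suc n) ` F n False \<subseteq> N" using n by (simp_all add: Lg_eq_F)
    show "cell n (\<lambda>_. False) False 0 \<subseteq> N"
    proof (rule cell_zero_subset[OF _ N(2)])
      fix a b assume "a \<in> N" "b \<in> N"
      then show "b \<circ> a \<in> N"
        using N(1) subgroup.m_closed[of N "AutT (Suc n)" a b] by (simp add: normal_LG_iff)
    qed (use N(1) xg_cell_F(1) in \<open>unfold normal_LG_iff, blast\<close>)
  qed
qed

lemma Kg_eq_even_cells:
  assumes n: "n > 0"
  shows "Kg (Suc n) = even_cells n 0"
proof (intro equalityI)
  have "generate (LG (Suc n)) (Hg (Suc n) \<union> {zg (Suc n)}) \<subseteq> even_cells n 0"
    using zg_cell[of n] cell_subset_even_cells[of "\<lambda>_. False" n 0]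
      cell_subset_even_cells[of "tri True True False" n 0] normal_even_cells[of n]
    by (intro group.generate_subgroup_incl[OF group_LG])
       (auto simp: Hg_eq_cell[OF n] xor3_def intro: normal_imp_subgroup)
  then show "Kg (Suc n) \<subseteq> even_cells n 0"
    unfolding Kg_def normal_closure_def using normal_even_cells by blast
  show "even_cells n 0 \<subseteq> Kg (Suc n)"
    unfolding Kg_def normal_closure_def
  proof (rule Inter_greatest)
    fix N assume "N \<in> {N. N \<lhd> LG (Suc n) \<and> generate (LG (Suc n)) (Hg (Suc n) \<union> {zg (Suc n)}) \<subseteq> N}"
    then have N: "N \<lhd> LG (Suc n)" "Hg (Suc n) \<union> {zg (Suc n)} \<subseteq> N"
      using generate.incl[of _ "Hg (Suc n) \<union> {zg (Suc n)}" "LG (Suc n)"] by blast+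
    show "even_cells n 0 \<subseteq> N"
      using N xg_cell_F(1)[of "Suc n"] emb_cell[of n]
      by (intro even_cells_subset) (auto simp: normal_LG_iff Hg_eq_cell[OF n] simp del: AutT_simps)
  qed
qed

section \<open>Cycle statistics\<close>

lemma cycle_type_eq_orbit_type: "cycle_type n \<sigma> = orbit_type \<sigma> (level n)"
  by (simp add: cycle_type_def orbit_type_def)

lemma F_image_level:
  assumes "a \<in> F n e"
  shows "a ` level m = level m"
  using F_level[OF assms] inj_on_subset[OF bij_is_inj[OF bij_F[OF assms]] subset_UNIV]
  by (intro endo_inj_surj finite_level)

lemma level_Suc: "level (Suc n) = (\<Union>i. (#) i ` level n)"
  by (auto simp: level_def length_Suc_conv)

section \<open>Cycle type of an element in terms of its components\<close>

context
  fixes n :: nat and f :: "3 \<Rightarrow> aut" and \<epsilon> :: "3 \<Rightarrow> bool" and e :: bool and k :: 3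
    and \<sigma> :: aut and B :: "3 \<Rightarrow> word set"
  assumes f: "\<And>i. f i \<in> F n (\<epsilon> i)" and perm: "permutation \<sigma>"
    and \<sigma>_def: "\<sigma> = W (Suc n) f (rot e k)"
    and B_def: "B = (\<lambda>i. (#) i ` level n)"
begin

lemma \<sigma>_Cons: "w \<in> level n \<Longrightarrow> \<sigma> (i # w) = rot e k i # f i w"
  by (simp add: \<sigma>_def level_def)

lemma f_level: "w \<in> level n \<Longrightarrow> f i w \<in> level n"
  using F_level[OF f] by blast

lemma \<sigma>_image_B: "\<sigma> ` B i = B (rot e k i)"
proof -
  have "\<sigma> ` B i = (#) (rot e k i) ` f i ` level n"
    unfolding B_def image_image by (intro image_cong refl \<sigma>_Cons)
  then show ?thesis by (simp add: F_image_level[OF f] B_def)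
qed

lemma finite_B: "finite (B i)"
  by (simp add: B_def finite_level)

lemma B_disjoint: "i \<noteq> j \<Longrightarrow> B i \<inter> B j = {}"
  by (auto simp: B_def)

lemma orbit_type_fixed:
  assumes "rot e k i = i"
  shows "orbit_type \<sigma> (B i) = cycle_type n (f i)"
proof -
  have "orbit_type \<sigma> (\<Union>j<1. (\<sigma> ^^ j) ` (#) i ` level n) = image_mset ((*) 1) (orbit_type (f i) (level n))"
    by (rule orbit_type_first_return[OF perm F_permutation[OF f] finite_level F_level[OF f]])
       (simp_all add: assms \<sigma>_Cons)
  moreover have "((*) (1::nat)) = (\<lambda>m. m)" by auto
  ultimately show ?thesis by (simp add: cycle_type_eq_orbit_type B_def lessThan_Suc)
qed

text \<open>The block \<open>B i\<close> is revisited every second step, and the return map is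
  \<open>f i\<close> followed by \<open>f j\<close>.\<close>

lemma orbit_type_two_cycle:
  assumes "rot e k i = j" "rot e k j = i" "i \<noteq> j"
  shows "orbit_type \<sigma> (B i \<union> B j) = image_mset ((*) 2) (cycle_type n (f j \<circ> f i))"
proof -
  have F: "f j \<circ> f i \<in> F n (\<epsilon> i \<noteq> \<epsilon> j)" by (rule F_mult[OF f f])
  \<comment> \<open>The bound \<open>j\<close> counts iterations and shadows the letter
    \<open>j\<close>.\<close>
  have "orbit_type \<sigma> (\<Union>j<2. (\<sigma> ^^ j) ` (#) i ` level n) =
      image_mset ((*) 2) (orbit_type (f j \<circ> f i) (level n))"
    by (rule orbit_type_first_return[OF perm F_permutation[OF F] finite_level F_level[OF F]])
       (use assms in \<open>auto simp: \<sigma>_Cons f_level numeral_2_eq_2 less_Suc_eq\<close>)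
  also have "(\<Union>j<2. (\<sigma> ^^ j) ` (#) i ` level n) = B i \<union> B j"
    using \<sigma>_image_B[of i] assms by (auto simp: B_def numeral_2_eq_2 lessThan_Suc)
  finally show ?thesis unfolding cycle_type_eq_orbit_type .
qed

lemma orbit_type_three_cycle:
  assumes "rot e k i = j" "rot e k j = l" "rot e k l = i" "i \<noteq> j" "i \<noteq> l"
  shows "orbit_type \<sigma> (B i \<union> B j \<union> B l) = image_mset ((*) 3) (cycle_type n (f l \<circ> (f j \<circ> f i)))"
proof -
  have F: "f l \<circ> (f j \<circ> f i) \<in> F n ((\<epsilon> i \<noteq> \<epsilon> j) \<noteq> \<epsilon> l)" by (intro F_mult f)
  have "orbit_type \<sigma> (\<Union>j<3. (\<sigma> ^^ j) ` (#) i ` level n) =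
      image_mset ((*) 3) (orbit_type (f l \<circ> (f j \<circ> f i)) (level n))"
    by (rule orbit_type_first_return[OF perm F_permutation[OF F] finite_level F_level[OF F]])
       (use assms in \<open>auto simp: \<sigma>_Cons f_level numeral_3_eq_3 less_Suc_eq\<close>)
  also have "(\<Union>j<3. (\<sigma> ^^ j) ` (#) i ` level n) = B i \<union> \<sigma> ` B i \<union> \<sigma> ` \<sigma> ` B i"
    by (simp add: B_def numeral_3_eq_3 lessThan_Suc image_comp) blast
  also have "\<dots> = B i \<union> B j \<union> B l" by (simp add: \<sigma>_image_B assms)
  finally show ?thesis unfolding cycle_type_eq_orbit_type .
qed

lemma level_eq_B: "level (Suc n) = B 0 \<union> B 1 \<union> B 2"
  by (simp add: level_Suc UNIV_three B_def Un_assoc)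

lemma cycle_type_three_cycle:
  assumes "rot e k 0 = i" "rot e k i = j" "rot e k j = 0" "i \<noteq> 0" "j \<noteq> 0" "i \<noteq> j"
  shows "cycle_type (Suc n) \<sigma> = image_mset ((*) 3) (cycle_type n (f j \<circ> (f i \<circ> f 0)))"
proof -
  have "level (Suc n) = B 0 \<union> B i \<union> B j"
    using exhaust_three[of i] exhaust_three[of j] assms(4-6) by (auto simp: level_eq_B)
  then show ?thesis
    using orbit_type_three_cycle[OF assms(1-3)] assms(4-5) by (simp add: cycle_type_eq_orbit_type)
qed

lemma cycle_type_transposition:
  assumes "rot e k i = i" "rot e k j = l" "rot e k l = j" "j \<noteq> l" "i \<noteq> j" "i \<noteq> l"
  shows "cycle_type (Suc n) \<sigma> = cycle_type n (f i) + image_mset ((*) 2) (cycle_type n (f l \<circ> f j))"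
proof -
  have lev: "level (Suc n) = B i \<union> (B j \<union> B l)"
    using exhaust_three[of i] exhaust_three[of j] exhaust_three[of l] assms(4-6)
    by (auto simp: level_eq_B)
  have "orbit_type \<sigma> (B i \<union> (B j \<union> B l)) = orbit_type \<sigma> (B i) + orbit_type \<sigma> (B j \<union> B l)"
  proof (rule orbit_type_Un[OF perm])
    show "B i \<inter> (B j \<union> B l) = {}" using B_disjoint[of i j] B_disjoint[of i l] assms by blast
    show "\<sigma> ` B i \<subseteq> B i" "\<sigma> ` (B j \<union> B l) \<subseteq> B j \<union> B l"
      by (simp_all add: image_Un \<sigma>_image_B assms)
  qed (simp_all add: finite_B)
  then show ?thesis
    unfolding lev cycle_type_eq_orbit_type[of "Suc n"]
    by (simp add: orbit_type_fixed[OF assms(1)] orbit_type_two_cycle[OF assms(2-4)])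
qed

lemma cycle_type_identity:
  assumes "rot e k = id"
  shows "cycle_type (Suc n) \<sigma> = cycle_type n (f 0) + cycle_type n (f 1) + cycle_type n (f 2)"
proof -
  have r: "rot e k i = i" for i by (simp add: assms)
  have inv: "\<sigma> ` B i \<subseteq> B i" for i by (simp add: \<sigma>_image_B r)
  have "orbit_type \<sigma> (B 0 \<union> B 1 \<union> B 2) = orbit_type \<sigma> (B 0 \<union> B 1) + orbit_type \<sigma> (B 2)"
    using B_disjoint[of 0 2] B_disjoint[of 1 2] inv[of 0] inv[of 1] inv[of 2]
    by (intro orbit_type_Un[OF perm]) (auto simp: finite_B)
  also have "orbit_type \<sigma> (B 0 \<union> B 1) = orbit_type \<sigma> (B 0) + orbit_type \<sigma> (B 1)"
    using B_disjoint[of 0 1] inv[of 0] inv[of 1]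
    by (intro orbit_type_Un[OF perm]) (auto simp: finite_B)
  finally show ?thesis
    unfolding cycle_type_eq_orbit_type[of "Suc n"] level_eq_B by (simp add: orbit_type_fixed r)
qed

end

section \<open>Uniformly distributed elements of cells\<close>

lemma pmf_of_set_Times:
  assumes "finite A" "A \<noteq> {}" "finite B" "B \<noteq> {}"
  shows "pmf_of_set (A \<times> B) = pair_pmf (pmf_of_set A) (pmf_of_set B)"
proof (rule pmf_eqI)
  fix x :: "'a \<times> 'b"
  show "pmf (pmf_of_set (A \<times> B)) x = pmf (pair_pmf (pmf_of_set A) (pmf_of_set B)) x"
    using assms by (cases x) (simp add: pmf_pair card_cartesian_product indicator_def)
qed

lemma F_nonempty: "F n e \<noteq> {}"
  using id_in_F[of n] yg_F[of n] by (cases e) auto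

text \<open>One-letter words determine the permutation, and words \<open>i # w\<close> with
  \<open>w\<close> of length at most \<open>n\<close> the components; on longer words all components
  are the identity.\<close>

lemma W_eq_iff:
  assumes "\<And>i. f i \<in> F n (\<epsilon> i)" "\<And>i. g i \<in> F n (\<delta> i)"
  shows "W (Suc n) f \<pi> = W (Suc n) g \<rho> \<longleftrightarrow> f = g \<and> \<pi> = \<rho>"
proof
  assume eq: "W (Suc n) f \<pi> = W (Suc n) g \<rho>"
  have "\<pi> i = \<rho> i" for i using fun_cong[OF eq, of "[i]"] by simp
  moreover have "f i w = g i w" for i w
    using fun_cong[OF eq, of "i # w"] F_fixes_long[OF assms(1), of w i] F_fixes_long[OF assms(2), of w i]
    by (cases "length w \<le> n") auto
  ultimately show "f = g \<and> \<pi> = \<rho>" by (simp add: fun_eq_iff)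
qed simp

text \<open>A reflection is never a rotation: comparing values at 0 and 1 would give
  \<open>2 = 0\<close> modulo 3. Level 0 is excluded because both signs describe \<open>{id}\<close>
  there.\<close>

lemma F_disjoint: "n > 0 \<Longrightarrow> F n True \<inter> F n False = {}"
proof (rule equals0I)
  fix a assume "n > 0" "a \<in> F n True \<inter> F n False"
  then obtain m where [simp]: "n = Suc m" by (cases n) auto
  obtain f \<epsilon> k g \<delta> l where *: "a = W n f (rot True k)" "\<And>i. f i \<in> F m (\<epsilon> i)"
      "a = W n g (rot False l)" "\<And>i. g i \<in> F m (\<delta> i)"
    using \<open>a \<in> _\<close> unfolding \<open>n = Suc m\<close> F.simps by blast
  have eq: "rot True k = rot False l"
    using W_eq_iff[of f m \<epsilon> g \<delta> "rot True k" "rot False l", OF *(2,4)] *(1,3) by simp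
  have "k - 0 = l + 0" "k - 1 = l + 1"
    using fun_cong[OF eq, of 0] fun_cong[OF eq, of 1] by (simp_all add: rot_def)
  then have "(2::3) = 0" by (simp add: algebra_simps)
  then show False by simp
qed

lemma F_sign_unique: "n > 0 \<Longrightarrow> a \<in> F n e \<Longrightarrow> a \<in> F n e' \<Longrightarrow> e = e'"
  using F_disjoint[of n] by (cases e; cases e') auto

lemma card_F: "card (F n e) = card (F n False)"
proof (cases e)
  case True
  have "F n True = (\<lambda>a. yg n \<circ> a) ` F n False"
    unfolding F_True_coset r_coset_def by auto
  moreover have "inj_on (\<lambda>a. yg n \<circ> a) (F n False)"
    using injD[OF bij_is_inj[OF bij_F[OF yg_F]]] by (intro inj_onI ext) (auto dest!: fun_cong)
  ultimately show ?thesis using True by (simp add: card_image)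
qed simp

lemma cell_eq_image:
  "cell n \<epsilon> e k = (\<lambda>(a, b, c). W (Suc n) (tri a b c) (rot e k)) ` (F n (\<epsilon> 0) \<times> F n (\<epsilon> 1) \<times> F n (\<epsilon> 2))"
  (is "_ = ?h ` ?X")
proof (intro equalityI subsetI)
  fix s assume "s \<in> cell n \<epsilon> e k"
  then obtain f where "s = W (Suc n) f (rot e k)" "\<And>i. f i \<in> F n (\<epsilon> i)" by (auto simp: cell_def)
  then show "s \<in> ?h ` ?X"
    by (intro image_eqI[of _ _ "(f 0, f 1, f 2)"]) (simp_all add: tri_eta)
next
  fix s assume "s \<in> ?h ` ?X"
  then obtain a b c where *: "a \<in> F n (\<epsilon> 0)" "b \<in> F n (\<epsilon> 1)" "c \<in> F n (\<epsilon> 2)"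
    "s = W (Suc n) (tri a b c) (rot e k)" by auto
  have "\<forall>i. tri a b c i \<in> F n (\<epsilon> i)" unfolding all_three using * by simp
  then show "s \<in> cell n \<epsilon> e k" unfolding *(4) by (intro cellI) blast
qed

lemma tri_eq_iff [simp]: "tri a b c = tri a' b' c' \<longleftrightarrow> a = a' \<and> b = b' \<and> c = c'"
  unfolding fun_eq_iff all_three by simp

lemma inj_on_cell:
  fixes \<epsilon> :: "3 \<Rightarrow> bool"
  shows "inj_on (\<lambda>(a, b, c). W (Suc n) (tri a b c) (rot e k)) (F n (\<epsilon> 0) \<times> F n (\<epsilon> 1) \<times> F n (\<epsilon> 2))"
proof (rule inj_onI)
  fix u v
  assume uv: "u \<in> F n (\<epsilon> 0) \<times> F n (\<epsilon> 1) \<times> F n (\<epsilon> 2)" "v \<in> F n (\<epsilon> 0) \<times> F n (\<epsilon> 1) \<times> F n (\<epsilon> 2)"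
    and eq: "(\<lambda>(a, b, c). W (Suc n) (tri a b c) (rot e k)) u =
      (\<lambda>(a, b, c). W (Suc n) (tri a b c) (rot e k)) v"
  obtain a b c a' b' c' where [simp]: "u = (a, b, c)" "v = (a', b', c')" by (cases u, cases v)
  have "\<forall>i. tri a b c i \<in> F n (\<epsilon> i)" "\<forall>i. tri a' b' c' i \<in> F n (\<epsilon> i)"
    unfolding all_three using uv by simp_all
  with eq show "u = v" using W_eq_iff[of "tri a b c" n \<epsilon> "tri a' b' c'" \<epsilon>] by auto
qed

lemma finite_cell: "finite (cell n \<epsilon> e k)"
  by (simp add: cell_eq_image finite_F)

lemma card_cell: "card (cell n \<epsilon> e k) = card (F n False) ^ 3"
  unfolding cell_eq_image card_image[OF inj_on_cell]
  by (simp add: card_cartesian_product card_F[of n "\<epsilon> _"] power3_eq_cube)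

lemma cell_nonempty: "cell n \<epsilon> e k \<noteq> {}"
  by (simp add: cell_eq_image F_nonempty)

definition unif :: "nat \<Rightarrow> bool \<Rightarrow> aut pmf" where
  "unif n e = pmf_of_set (F n e)"

lemma set_pmf_unif [simp]: "set_pmf (unif n e) = F n e"
  by (simp add: unif_def set_pmf_of_set F_nonempty finite_F)

lemma pmf_of_set_cell:
  "pmf_of_set (cell n \<epsilon> e k) =
     bind_pmf (unif n (\<epsilon> 0)) (\<lambda>a. bind_pmf (unif n (\<epsilon> 1)) (\<lambda>b. bind_pmf (unif n (\<epsilon> 2)) (\<lambda>c.
       return_pmf (W (Suc n) (tri a b c) (rot e k)))))"
proof -
  let ?h = "\<lambda>(a, b, c). W (Suc n) (tri a b c) (rot e k)"
  have "pmf_of_set (cell n \<epsilon> e k) = map_pmf ?h (pmf_of_set (F n (\<epsilon> 0) \<times> F n (\<epsilon> 1) \<times> F n (\<epsilon> 2)))"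
    unfolding cell_eq_image
    by (rule map_pmf_of_set_inj[symmetric, OF inj_on_cell]) (simp_all add: F_nonempty finite_F)
  also have "\<dots> = map_pmf ?h (pair_pmf (unif n (\<epsilon> 0)) (pair_pmf (unif n (\<epsilon> 1)) (unif n (\<epsilon> 2))))"
    by (simp add: pmf_of_set_Times F_nonempty finite_F unif_def)
  finally show ?thesis
    by (simp add: pair_pmf_def map_pmf_def bind_assoc_pmf bind_return_pmf)
qed

text \<open>For fixed \<open>a\<close>, composition with \<open>a\<close> is a bijection from
  \<open>F n e'\<close> onto the set of the product sign, so the product is uniform whatever
  \<open>a\<close> is. This collapses the components along a cycle into one sample.\<close>

lemma bind_unif_comp:
  "bind_pmf (unif n e) (\<lambda>a. bind_pmf (unif n e') (\<lambda>b. h (b \<circ> a))) = bind_pmf (unif n (e \<noteq> e')) h"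
proof -
  have "map_pmf (\<lambda>b. b \<circ> a) (unif n e') = unif n (e \<noteq> e')" if a: "a \<in> F n e" for a
  proof -
    obtain c where c: "c \<in> F n e" "c \<circ> a = id" "a \<circ> c = id" using F_inv[OF a] by blast
    have "inj_on (\<lambda>b. b \<circ> a) (F n e')"
    proof (rule inj_onI)
      fix b b' assume "b \<circ> a = b' \<circ> a"
      then have "b \<circ> (a \<circ> c) = b' \<circ> (a \<circ> c)" by (simp only: comp_assoc[symmetric])
      then show "b = b'" by (simp add: c(3))
    qed
    moreover have "(\<lambda>b. b \<circ> a) ` F n e' = F n (e \<noteq> e')"
    proof (intro equalityI subsetI)
      fix s assume "s \<in> F n (e \<noteq> e')"
      from F_mult[OF c(1) this] have "s \<circ> c \<in> F n e'" by (cases e) simp_all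
      moreover have "s = (s \<circ> c) \<circ> a" using c(2) by (simp add: comp_assoc)
      ultimately show "s \<in> (\<lambda>b. b \<circ> a) ` F n e'" by blast
    qed (use F_mult[OF a] in auto)
    ultimately show ?thesis
      unfolding unif_def by (subst map_pmf_of_set_inj) (simp_all add: F_nonempty finite_F)
  qed
  then have "bind_pmf (unif n e') (\<lambda>b. h (b \<circ> a)) = bind_pmf (unif n (e \<noteq> e')) h" if "a \<in> F n e" for a
    using bind_map_pmf[of "\<lambda>b. b \<circ> a" "unif n e'" h] that by simp
  then have "bind_pmf (unif n e) (\<lambda>a. bind_pmf (unif n e') (\<lambda>b. h (b \<circ> a))) =
      bind_pmf (unif n e) (\<lambda>a. bind_pmf (unif n (e \<noteq> e')) h)"
    by (intro bind_pmf_cong[of "unif n e", OF refl]) (simp only: set_pmf_unif)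
  then show ?thesis by simp
qed

definition cycle_dist :: "nat \<Rightarrow> bool \<Rightarrow> nat multiset pmf" where
  "cycle_dist n e = map_pmf (cycle_type n) (unif n e)"

definition cell_dist :: "nat \<Rightarrow> (3 \<Rightarrow> bool) \<Rightarrow> bool \<Rightarrow> 3 \<Rightarrow> nat multiset pmf" where
  "cell_dist n \<epsilon> e k = map_pmf (cycle_type (Suc n)) (pmf_of_set (cell n \<epsilon> e k))"

lemma cell_dist_bind:
  assumes "\<And>a b c. a \<in> F n (\<epsilon> 0) \<Longrightarrow> b \<in> F n (\<epsilon> 1) \<Longrightarrow> c \<in> F n (\<epsilon> 2) \<Longrightarrow>
    cycle_type (Suc n) (W (Suc n) (tri a b c) (rot e k)) = h a b c"
  shows "cell_dist n \<epsilon> e k =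
     bind_pmf (unif n (\<epsilon> 0)) (\<lambda>a. bind_pmf (unif n (\<epsilon> 1)) (\<lambda>b. bind_pmf (unif n (\<epsilon> 2)) (\<lambda>c.
       return_pmf (h a b c))))"
  unfolding cell_dist_def pmf_of_set_cell map_bind_pmf map_return_pmf
  by (intro bind_pmf_cong refl arg_cong[of _ _ return_pmf] assms) simp_all

lemma tri_F:
  assumes "a \<in> F n (\<epsilon> 0)" "b \<in> F n (\<epsilon> 1)" "c \<in> F n (\<epsilon> 2)"
  shows "tri a b c i \<in> F n (\<epsilon> i)"
proof -
  have "\<forall>i. tri a b c i \<in> F n (\<epsilon> i)" unfolding all_three using assms by simp
  then show ?thesis ..
qed

lemma permutation_W:
  assumes "\<And>i. f i \<in> F n (\<epsilon> i)" "xor3 \<epsilon> = e"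
  shows "permutation (W (Suc n) f (rot e k))"
  using cell_subset_F[OF assms(2)] cellI[of f n \<epsilon> e k] assms(1) F_permutation by blast

lemma rot_values:
  "rot False 1 0 = 1" "rot False 1 1 = 2" "rot False 1 2 = 0"
  "rot False 2 0 = 2" "rot False 2 1 = 0" "rot False 2 2 = 1"
  "rot True 0 0 = 0" "rot True 0 1 = 2" "rot True 0 2 = 1"
  "rot True 1 0 = 1" "rot True 1 1 = 0" "rot True 1 2 = 2"
  "rot True 2 0 = 2" "rot True 2 1 = 1" "rot True 2 2 = 0"
  by (simp_all add: rot_def)

lemma cell_dist_identity:
  assumes "\<not> xor3 \<epsilon>"
  shows "cell_dist n \<epsilon> False 0 =
      conv (cycle_dist n (\<epsilon> 0)) (conv (cycle_dist n (\<epsilon> 1)) (cycle_dist n (\<epsilon> 2)))"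
proof -
  have "cell_dist n \<epsilon> False 0 =
      bind_pmf (unif n (\<epsilon> 0)) (\<lambda>a. bind_pmf (unif n (\<epsilon> 1)) (\<lambda>b. bind_pmf (unif n (\<epsilon> 2)) (\<lambda>c.
      return_pmf (cycle_type n a + cycle_type n b + cycle_type n c))))"
  proof (rule cell_dist_bind)
    fix a b c assume "a \<in> F n (\<epsilon> 0)" "b \<in> F n (\<epsilon> 1)" "c \<in> F n (\<epsilon> 2)"
    note * = tri_F[OF this]
    show "cycle_type (Suc n) (W (Suc n) (tri a b c) (rot False 0)) =
        cycle_type n a + cycle_type n b + cycle_type n c"
      using cycle_type_identity[OF * permutation_W[OF *] refl refl rot_zero] assms by simp
  qed
  also have "\<dots> = conv (cycle_dist n (\<epsilon> 0)) (conv (cycle_dist n (\<epsilon> 1)) (cycle_dist n (\<epsilon> 2)))"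
    by (simp add: cycle_dist_def conv_altdef map_pmf_def bind_assoc_pmf bind_return_pmf add.assoc)
  finally show ?thesis .
qed

text \<open>All three components are multiplied along one cycle, and their signs multiply to even.
  Hence every cell over a 3-cycle has the same distribution.\<close>

lemma cell_dist_three_cycle:
  assumes "\<not> xor3 \<epsilon>" "k \<noteq> 0"
  shows "cell_dist n \<epsilon> False k = map_pmf (image_mset ((*) 3)) (cycle_dist n False)"
proof -
  have k: "k = 1 \<or> k = 2" using exhaust_three[of k] assms(2) by blast
  then show ?thesis
  proof
    assume k: "k = 1"
    have "cell_dist n \<epsilon> False k =
        bind_pmf (unif n (\<epsilon> 0)) (\<lambda>a. bind_pmf (unif n (\<epsilon> 1)) (\<lambda>b. bind_pmf (unif n (\<epsilon> 2)) (\<lambda>c.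
        return_pmf (image_mset ((*) 3) (cycle_type n (c \<circ> (b \<circ> a)))))))"
    proof (rule cell_dist_bind)
      fix a b c assume "a \<in> F n (\<epsilon> 0)" "b \<in> F n (\<epsilon> 1)" "c \<in> F n (\<epsilon> 2)"
      note * = tri_F[OF this]
      show "cycle_type (Suc n) (W (Suc n) (tri a b c) (rot False k)) =
          image_mset ((*) 3) (cycle_type n (c \<circ> (b \<circ> a)))"
        using cycle_type_three_cycle[OF * permutation_W[OF *] refl refl,
          where k = k and e = False and i = 1 and j = 2] assms k
        by (simp add: rot_values)
    qed
    also have "\<dots> = bind_pmf (unif n ((\<epsilon> 0 \<noteq> \<epsilon> 1) \<noteq> \<epsilon> 2)) (\<lambda>s. return_pmf (image_mset ((*) 3) (cycle_type n s)))"
      by (subst bind_unif_comp, subst bind_unif_comp) (rule refl)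
    also have "((\<epsilon> 0 \<noteq> \<epsilon> 1) \<noteq> \<epsilon> 2) = False" using assms by (auto simp: xor3_def)
    finally show ?thesis by (simp add: cycle_dist_def map_pmf_def bind_assoc_pmf bind_return_pmf)
  next
    assume k: "k = 2"
    have "cell_dist n \<epsilon> False k =
        bind_pmf (unif n (\<epsilon> 0)) (\<lambda>a. bind_pmf (unif n (\<epsilon> 1)) (\<lambda>b. bind_pmf (unif n (\<epsilon> 2)) (\<lambda>c.
        return_pmf (image_mset ((*) 3) (cycle_type n (b \<circ> (c \<circ> a)))))))"
    proof (rule cell_dist_bind)
      fix a b c assume "a \<in> F n (\<epsilon> 0)" "b \<in> F n (\<epsilon> 1)" "c \<in> F n (\<epsilon> 2)"
      note * = tri_F[OF this]
      show "cycle_type (Suc n) (W (Suc n) (tri a b c) (rot False k)) =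
          image_mset ((*) 3) (cycle_type n (b \<circ> (c \<circ> a)))"
        using cycle_type_three_cycle[OF * permutation_W[OF *] refl refl,
          where k = k and e = False and i = 2 and j = 1] assms k
        by (simp add: rot_values)
    qed
    \<comment> \<open>The cycle now runs through 0, 2, 1, so \<open>c\<close> must be drawn before
      \<open>b\<close> for \<open>bind_unif_comp\<close> to apply.\<close>
    also have "\<dots> =
        bind_pmf (unif n (\<epsilon> 0)) (\<lambda>a. bind_pmf (unif n (\<epsilon> 2)) (\<lambda>c. bind_pmf (unif n (\<epsilon> 1)) (\<lambda>b.
        return_pmf (image_mset ((*) 3) (cycle_type n (b \<circ> (c \<circ> a)))))))"
      by (intro bind_pmf_cong refl bind_commute_pmf)
    also have "\<dots> = bind_pmf (unif n ((\<epsilon> 0 \<noteq> \<epsilon> 2) \<noteq> \<epsilon> 1)) (\<lambda>s. return_pmf (image_mset ((*) 3) (cycle_type n s)))"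
      by (subst bind_unif_comp, subst bind_unif_comp) (rule refl)
    also have "((\<epsilon> 0 \<noteq> \<epsilon> 2) \<noteq> \<epsilon> 1) = False" using assms by (auto simp: xor3_def)
    finally show ?thesis by (simp add: cycle_dist_def map_pmf_def bind_assoc_pmf bind_return_pmf)
  qed
qed

lemma conv_cycle_dist_bind:
  "conv (cycle_dist n e) (map_pmf (image_mset ((*) 2)) (cycle_dist n e')) =
   bind_pmf (unif n e) (\<lambda>a. bind_pmf (unif n e') (\<lambda>s.
     return_pmf (cycle_type n a + image_mset ((*) 2) (cycle_type n s))))"
  by (simp add: cycle_dist_def conv_altdef map_pmf_def bind_assoc_pmf bind_return_pmf)

text \<open>The reflection \<open>k - i\<close> fixes the letter \<open>2k\<close> modulo 3. Its
  component contributes unchanged, while the other two are multiplied along a 2-cycle.\<close>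

lemma cell_dist_transposition:
  assumes "xor3 \<epsilon>"
  shows "cell_dist n \<epsilon> True 0 =
      conv (cycle_dist n (\<epsilon> 0)) (map_pmf (image_mset ((*) 2)) (cycle_dist n (\<epsilon> 1 \<noteq> \<epsilon> 2)))"
    and "cell_dist n \<epsilon> True 1 =
        conv (cycle_dist n (\<epsilon> 2)) (map_pmf (image_mset ((*) 2)) (cycle_dist n (\<epsilon> 0 \<noteq> \<epsilon> 1)))"
    and "cell_dist n \<epsilon> True 2 =
        conv (cycle_dist n (\<epsilon> 1)) (map_pmf (image_mset ((*) 2)) (cycle_dist n (\<epsilon> 0 \<noteq> \<epsilon> 2)))"
proof -
  let ?ct = "\<lambda>a s. return_pmf (cycle_type n a + image_mset ((*) 2) (cycle_type n s))"
  have "cell_dist n \<epsilon> True 0 =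
      bind_pmf (unif n (\<epsilon> 0)) (\<lambda>a. bind_pmf (unif n (\<epsilon> 1)) (\<lambda>b. bind_pmf (unif n (\<epsilon> 2)) (\<lambda>c.
      ?ct a (c \<circ> b))))"
  proof (rule cell_dist_bind)
    fix a b c assume "a \<in> F n (\<epsilon> 0)" "b \<in> F n (\<epsilon> 1)" "c \<in> F n (\<epsilon> 2)"
    note * = tri_F[OF this]
    show "cycle_type (Suc n) (W (Suc n) (tri a b c) (rot True 0)) =
        cycle_type n a + image_mset ((*) 2) (cycle_type n (c \<circ> b))"
      using cycle_type_transposition[OF * permutation_W[OF *] refl refl,
          where e = True and k = 0 and i = 0 and j = 1 and l = 2] assms
      by (simp add: rot_values)
  qed
  then show "cell_dist n \<epsilon> True 0 =
      conv (cycle_dist n (\<epsilon> 0)) (map_pmf (image_mset ((*) 2)) (cycle_dist n (\<epsilon> 1 \<noteq> \<epsilon> 2)))"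
    unfolding conv_cycle_dist_bind bind_unif_comp[of n _ _ "?ct _"] .
  have "cell_dist n \<epsilon> True 1 =
      bind_pmf (unif n (\<epsilon> 0)) (\<lambda>a. bind_pmf (unif n (\<epsilon> 1)) (\<lambda>b. bind_pmf (unif n (\<epsilon> 2)) (\<lambda>c.
      ?ct c (b \<circ> a))))"
  proof (rule cell_dist_bind)
    fix a b c assume "a \<in> F n (\<epsilon> 0)" "b \<in> F n (\<epsilon> 1)" "c \<in> F n (\<epsilon> 2)"
    note * = tri_F[OF this]
    show "cycle_type (Suc n) (W (Suc n) (tri a b c) (rot True 1)) =
        cycle_type n c + image_mset ((*) 2) (cycle_type n (b \<circ> a))"
      using cycle_type_transposition[OF * permutation_W[OF *] refl refl,
          where e = True and k = 1 and i = 2 and j = 0 and l = 1] assms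
      by (simp add: rot_values)
  qed
  also have "\<dots> = bind_pmf (unif n (\<epsilon> 0 \<noteq> \<epsilon> 1)) (\<lambda>s. bind_pmf (unif n (\<epsilon> 2)) (\<lambda>c. ?ct c s))"
    by (rule bind_unif_comp[of n _ _ "\<lambda>s. bind_pmf (unif n (\<epsilon> 2)) (\<lambda>c. ?ct c s)"])
  \<comment> \<open>The fixed letter is 2, so its sample comes last and has to be moved to the
    front.\<close>
  also have "\<dots> =
      bind_pmf (unif n (\<epsilon> 2)) (\<lambda>c. bind_pmf (unif n (\<epsilon> 0 \<noteq> \<epsilon> 1)) (\<lambda>s. ?ct c s))"
    by (rule bind_commute_pmf)
  finally show "cell_dist n \<epsilon> True 1 =
      conv (cycle_dist n (\<epsilon> 2)) (map_pmf (image_mset ((*) 2)) (cycle_dist n (\<epsilon> 0 \<noteq> \<epsilon> 1)))"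
    unfolding conv_cycle_dist_bind .
  have "cell_dist n \<epsilon> True 2 =
      bind_pmf (unif n (\<epsilon> 0)) (\<lambda>a. bind_pmf (unif n (\<epsilon> 1)) (\<lambda>b. bind_pmf (unif n (\<epsilon> 2)) (\<lambda>c.
      ?ct b (c \<circ> a))))"
  proof (rule cell_dist_bind)
    fix a b c assume "a \<in> F n (\<epsilon> 0)" "b \<in> F n (\<epsilon> 1)" "c \<in> F n (\<epsilon> 2)"
    note * = tri_F[OF this]
    show "cycle_type (Suc n) (W (Suc n) (tri a b c) (rot True 2)) =
        cycle_type n b + image_mset ((*) 2) (cycle_type n (c \<circ> a))"
      using cycle_type_transposition[OF * permutation_W[OF *] refl refl,
          where e = True and k = 2 and i = 1 and j = 0 and l = 2] assms
      by (simp add: rot_values)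
  qed
  also have "\<dots> =
      bind_pmf (unif n (\<epsilon> 1)) (\<lambda>b. bind_pmf (unif n (\<epsilon> 0)) (\<lambda>a. bind_pmf (unif n (\<epsilon> 2)) (\<lambda>c. ?ct b (c \<circ> a))))"
    by (rule bind_commute_pmf)
  finally show "cell_dist n \<epsilon> True 2 =
      conv (cycle_dist n (\<epsilon> 1)) (map_pmf (image_mset ((*) 2)) (cycle_dist n (\<epsilon> 0 \<noteq> \<epsilon> 2)))"
    unfolding conv_cycle_dist_bind bind_unif_comp[of n _ _ "?ct _"] .
qed

section \<open>Counting over disjoint cells\<close>

lemma card_filter_eq_pmf:
  assumes "finite S" "S \<noteq> {}"
  shows "real (card {\<sigma> \<in> S. h \<sigma> = p}) = real (card S) * pmf (map_pmf h (pmf_of_set S)) p"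
proof -
  have "S \<inter> h -` {p} = {\<sigma> \<in> S. h \<sigma> = p}" by auto
  with assms show ?thesis by (simp add: pmf_map measure_pmf_of_set)
qed

text \<open>All cells have the same size, so disjoint cells contribute their distributions with
  equal weight.\<close>

lemma card_cycle_type_cells:
  assumes I: "finite I" and disj: "disjoint_family_on (\<lambda>(k, \<epsilon>). cell n \<epsilon> e k) I"
    and S: "S = (\<Union>(k, \<epsilon>)\<in>I. cell n \<epsilon> e k)"
  shows "card S = card I * card (F n False) ^ 3"
    and "real (card {\<sigma> \<in> S. cycle_type (Suc n) \<sigma> = p}) =
      real (card (F n False)) ^ 3 * (\<Sum>(k, \<epsilon>)\<in>I. pmf (cell_dist n \<epsilon> e k) p)"
proof -
  let ?C = "\<lambda>(k, \<epsilon>). cell n \<epsilon> e k"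
  have disj': "\<forall>i\<in>I. \<forall>j\<in>I. i \<noteq> j \<longrightarrow> ?C i \<inter> ?C j = {}"
    using disj unfolding disjoint_family_on_def .
  have "card S = (\<Sum>i\<in>I. card (?C i))"
    unfolding S using I disj' by (intro card_UN_disjoint) (auto simp: finite_cell)
  also have "\<dots> = (\<Sum>i\<in>I. card (F n False) ^ 3)"
    by (intro sum.cong refl) (auto simp: card_cell)
  finally show "card S = card I * card (F n False) ^ 3" by simp
  let ?P = "\<lambda>A. {\<sigma> \<in> A. cycle_type (Suc n) \<sigma> = p}"
  have "?P S = (\<Union>i\<in>I. ?P (?C i))" unfolding S by auto
  also have "card \<dots> = (\<Sum>i\<in>I. card (?P (?C i)))"
  proof (rule card_UN_disjoint[OF I])
    show "\<forall>i\<in>I. finite (?P (?C i))" by (auto simp: finite_cell)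
    show "\<forall>i\<in>I. \<forall>j\<in>I. i \<noteq> j \<longrightarrow> ?P (?C i) \<inter> ?P (?C j) = {}" using disj' by blast
  qed
  also have "real \<dots> = (\<Sum>(k, \<epsilon>)\<in>I. real (card (F n False)) ^ 3 * pmf (cell_dist n \<epsilon> e k) p)"
    unfolding of_nat_sum
    by (intro sum.cong refl)
       (auto simp: card_filter_eq_pmf finite_cell cell_nonempty card_cell cell_dist_def)
  finally show "real (card (?P S)) = real (card (F n False)) ^ 3 * (\<Sum>(k, \<epsilon>)\<in>I. pmf (cell_dist n \<epsilon> e k) p)"
    by (simp add: sum_distrib_left case_prod_unfold)
qed

text \<open>The signs can be read off only for \<open>n > 0\<close>, since \<open>F 0\<close> is the
  same set for both signs.\<close>

lemma cell_index_unique: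
  assumes "s \<in> cell n \<epsilon> e k" "s \<in> cell n \<epsilon>' e k'"
  shows "k = k'" and "n > 0 \<Longrightarrow> \<epsilon> = \<epsilon>'"
proof -
  obtain f g where f: "s = W (Suc n) f (rot e k)" "\<And>i. f i \<in> F n (\<epsilon> i)"
    and g: "s = W (Suc n) g (rot e k')" "\<And>i. g i \<in> F n (\<epsilon>' i)"
    using assms unfolding cell_def by blast
  have eq: "f = g" "rot e k = rot e k'"
    using W_eq_iff[of f n \<epsilon> g \<epsilon>' "rot e k" "rot e k'", OF f(2) g(2)] f(1) g(1) by simp_all
  show "k = k'" using fun_cong[OF eq(2), of 0] by (simp add: rot_def split: if_splits)
  show "\<epsilon> = \<epsilon>'" if "n > 0"
    using F_sign_unique[OF that f(2)] g(2) unfolding eq(1) by blast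
qed

lemma disjoint_cells: "n > 0 \<Longrightarrow> disjoint_family_on (\<lambda>(k, \<epsilon>). cell n \<epsilon> e k) I"
  by (auto simp: disjoint_family_on_def dest: cell_index_unique)

lemma xor3_set: "{\<epsilon>. xor3 \<epsilon> = e} =
  {tri False False e, tri False True (\<not> e), tri True False (\<not> e), tri True True e}"
proof (intro equalityI subsetI)
  fix \<epsilon> assume "\<epsilon> \<in> {\<epsilon>. xor3 \<epsilon> = e}"
  then have "\<epsilon> 2 = (e = (\<epsilon> 0 = \<epsilon> 1))" by (auto simp: xor3_def)
  then have "\<epsilon> = tri (\<epsilon> 0) (\<epsilon> 1) (e = (\<epsilon> 0 = \<epsilon> 1))" using tri_eta[of \<epsilon>] by simp
  then show "\<epsilon> \<in> {tri False False e, tri False True (\<not> e), tri True False (\<not> e), tri True True e}"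
    by (cases "\<epsilon> 0"; cases "\<epsilon> 1") auto
qed (auto simp: xor3_def)

lemma sum_xor3:
  fixes g :: "(3 \<Rightarrow> bool) \<Rightarrow> 'a :: comm_monoid_add"
  shows "(\<Sum>\<epsilon> | xor3 \<epsilon> = e. g \<epsilon>) =
    g (tri False False e) + (g (tri False True (\<not> e)) + (g (tri True False (\<not> e)) + g (tri True True e)))"
  unfolding xor3_set by simp

lemma card_xor3: "card {\<epsilon>. xor3 \<epsilon> = e} = 4"
  unfolding xor3_set by simp

lemma F_Suc_eq_UN: "F (Suc n) e = (\<Union>(k, \<epsilon>)\<in>UNIV \<times> {\<epsilon>. xor3 \<epsilon> = e}. cell n \<epsilon> e k)"
  unfolding F_Suc by auto

lemma card_F_Suc: "n > 0 \<Longrightarrow> card (F (Suc n) e) = 12 * card (F n False) ^ 3"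
  using card_cycle_type_cells(1)[OF _ disjoint_cells F_Suc_eq_UN[of n e]]
  by (simp add: card_cartesian_product card_xor3)

lemma card_F_pos: "card (F n e) > 0"
  using F_nonempty finite_F by (simp add: card_gt_0_iff)

text \<open>The average over twelve index pairs. For \<open>n > 0\<close> they index disjoint cells
  of equal size that make up \<open>F (Suc n) e\<close>.\<close>

lemma pmf_cycle_dist_Suc:
  "pmf (cycle_dist (Suc n) e) p = 1/12 * (\<Sum>k\<in>UNIV. \<Sum>\<epsilon> | xor3 \<epsilon> = e. pmf (cell_dist n \<epsilon> e k) p)"
proof -
  let ?c = "real (card (F n False))"
  have c: "?c > 0" using card_F_pos by simp
  have count: "real (card {\<sigma> \<in> F (Suc n) e. cycle_type (Suc n) \<sigma> = p}) =
      real (card (F (Suc n) e)) * pmf (cycle_dist (Suc n) e) p"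
    unfolding cycle_dist_def unif_def by (rule card_filter_eq_pmf[OF finite_F F_nonempty])
  show ?thesis
  proof (cases "n > 0")
    case True
    have "real (card {\<sigma> \<in> F (Suc n) e. cycle_type (Suc n) \<sigma> = p}) =
        ?c ^ 3 * (\<Sum>(k, \<epsilon>)\<in>UNIV \<times> {\<epsilon>. xor3 \<epsilon> = e}. pmf (cell_dist n \<epsilon> e k) p)"
      by (rule card_cycle_type_cells(2)[OF _ disjoint_cells F_Suc_eq_UN]) (simp_all add: True)
    then show ?thesis
      using count c by (simp add: card_F_Suc[OF True] sum.cartesian_product)
  next
    case False
    then have n: "n = 0" by simp
    \<comment> \<open>The four sign patterns give the same cell here, so there are only three cells.
      Each occurs four times in the sum, and the average is unchanged.\<close>
    have cell: "cell 0 \<epsilon> e k = cell 0 (\<lambda>_. e) e k" for \<epsilon> k by (simp add: cell_def)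
    then have dist: "cell_dist 0 \<epsilon> e k = cell_dist 0 (\<lambda>_. e) e k" for \<epsilon> k
      by (metis cell_dist_def)
    have F1: "F (Suc 0) e = (\<Union>(k, \<epsilon>)\<in>UNIV \<times> {\<lambda>_. e}. cell 0 \<epsilon> e k)"
      unfolding F_Suc using cell xor3_const[of e] by blast
    have disj: "disjoint_family_on (\<lambda>(k, \<epsilon>). cell 0 \<epsilon> e k) (UNIV \<times> {\<lambda>_. e})"
      by (auto simp: disjoint_family_on_def dest: cell_index_unique(1))
    have "card (F (Suc 0) e) = 3"
      using card_cycle_type_cells(1)[OF _ disj F1] by (simp add: card_cartesian_product)
    moreover have "real (card {\<sigma> \<in> F (Suc 0) e. cycle_type (Suc 0) \<sigma> = p}) =
        (\<Sum>k\<in>UNIV. pmf (cell_dist 0 (\<lambda>_. e) e k) p)"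
      using card_cycle_type_cells(2)[OF _ disj F1, of p] by (simp flip: sum.cartesian_product)
    ultimately have "3 * pmf (cycle_dist (Suc 0) e) p = (\<Sum>k\<in>UNIV. pmf (cell_dist 0 (\<lambda>_. e) e k) p)"
      using count n by simp
    moreover have "(\<Sum>\<epsilon> | xor3 \<epsilon> = e. pmf (cell_dist 0 \<epsilon> e k) p) = 4 * pmf (cell_dist 0 (\<lambda>_. e) e k) p" for k
    proof -
      have "(\<Sum>\<epsilon> | xor3 \<epsilon> = e. pmf (cell_dist 0 \<epsilon> e k) p) = (\<Sum>\<epsilon> | xor3 \<epsilon> = e. pmf (cell_dist 0 (\<lambda>_. e) e k) p)"
        by (intro sum.cong refl arg_cong2[of _ _ _ _ pmf] dist)
      then show ?thesis by (simp add: card_xor3)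
    qed
    ultimately show ?thesis
      unfolding n by (simp flip: sum_distrib_left)
  qed
qed

text \<open>The cells realize the branching weights. In the even half, eight of twelve lie over
  3-cycles, one is all even over the identity, and three over the identity have two odd components.
  In the odd half, the fixed component is even in six cells and odd in six, and the product along
  the 2-cycle has the opposite sign.\<close>

lemma cycle_dist_eq_process_dist: "cycle_dist n e = process_dist n {#(if e then Tn else Ts, 1)#}"
proof (induction n arbitrary: e)
  case 0
  have "level 0 = {[]}" by (auto simp: level_def)
  moreover have "orbit id [] = {[] :: word}" by (auto simp: orbit_altdef)
  ultimately have "cycle_type 0 id = {#1#}" by (simp add: cycle_type_def)
  then show ?case by (simp only: cycle_dist_def unif_def F.simps pmf_of_set_singleton map_return_pmf
      process_dist_def steps.simps image_mset_single snd_conv)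
next
  case (Suc n)
  have dist_eq: "process_dist n {#(Ts, 1)#} = cycle_dist n False"
    "process_dist n {#(Tn, 1)#} = cycle_dist n True"
    by (simp_all add: Suc)
  show ?case
  proof (rule pmf_eqI)
    fix p
    show "pmf (cycle_dist (Suc n) e) p = pmf (process_dist (Suc n) {#(if e then Tn else Ts, 1)#}) p"
    proof (cases e)
      case False
      have "cell_dist n \<epsilon> False k =
          (if k = 0 then conv (cycle_dist n (\<epsilon> 0)) (conv (cycle_dist n (\<epsilon> 1)) (cycle_dist n (\<epsilon> 2)))
          else map_pmf (image_mset ((*) 3)) (cycle_dist n False))" if "\<not> xor3 \<epsilon>" for \<epsilon> k
        using cell_dist_identity[OF that] cell_dist_three_cycle[OF that] by auto
      moreover have "\<not> xor3 (tri False False False)" "\<not> xor3 (tri False True True)"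
        "\<not> xor3 (tri True False True)" "\<not> xor3 (tri True True False)" by (simp_all add: xor3_def)
      ultimately show ?thesis
        unfolding pmf_cycle_dist_Suc sum_xor3 UNIV_three
        using False pmf_process_dist_Suc_Ts[of n p, unfolded dist_eq]
        by (simp add: conv_ac)
    next
      case True
      have "xor3 (tri False False True)" "xor3 (tri False True False)"
        "xor3 (tri True False False)" "xor3 (tri True True True)" by (simp_all add: xor3_def)
      then show ?thesis
        unfolding pmf_cycle_dist_Suc sum_xor3 UNIV_three
        using True pmf_process_dist_Suc_Tn[of n p, unfolded dist_eq]
        by (simp add: cell_dist_transposition)
    qed
  qed
qed

theorem theorem3p16:
  fixes n :: nat
  assumes "n \<ge> 2"
  defines "G \<equiv> AutT n" and "x \<equiv> xg n" and "y \<equiv> yg n" and "z \<equiv> zg n"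
    and "H \<equiv> Hg n" and "K \<equiv> Kg n" and "L \<equiv> Lg n" and "M \<equiv> Mg n"
  defines "x2 \<equiv> x [^]\<^bsub>G\<^esub> (2::nat)"
  defines "C0 \<equiv> z <#\<^bsub>G\<^esub> H"
    and "C1 \<equiv> (x \<otimes>\<^bsub>G\<^esub> z \<otimes>\<^bsub>G\<^esub> inv\<^bsub>G\<^esub> x) <#\<^bsub>G\<^esub> H"
    and "C2 \<equiv> (x2 \<otimes>\<^bsub>G\<^esub> z \<otimes>\<^bsub>G\<^esub> inv\<^bsub>G\<^esub> x2) <#\<^bsub>G\<^esub> H"
  shows "(\<forall>p \<in> partitions (3 ^ n). CD n H L p = A1 n p)
    \<and> ((K #>\<^bsub>G\<^esub> x) \<inter> (K #>\<^bsub>G\<^esub> x2) = {}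
       \<and> (\<forall>p \<in> partitions (3 ^ n). CD n ((K #>\<^bsub>G\<^esub> x) \<union> (K #>\<^bsub>G\<^esub> x2)) L p = A2 n p))
    \<and> (C0 \<inter> C1 = {} \<and> C0 \<inter> C2 = {} \<and> C1 \<inter> C2 = {}
       \<and> (\<forall>p \<in> partitions (3 ^ n). CD n (C0 \<union> C1 \<union> C2) L p = A3 n p))
    \<and> (\<forall>p \<in> partitions (3 ^ n). CD n (L #>\<^bsub>G\<^esub> y) M p = A4 (n + 1) p)"
proof -
  \<comment> \<open>Two successors are exposed: \<open>Mg_eq_F\<close> has this form, and
    \<open>m > 0\<close> makes the cells disjoint.\<close>
  obtain l where n: "n = Suc (Suc l)" using assms(1) by (metis Suc_le_D numeral_2_eq_2 Suc_le_mono)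
  define m where "m = Suc l"
  have nm: "n = Suc m" and m: "m > 0" by (simp_all add: n m_def)
  let ?c = "real (card (F m False))"
  have c: "?c > 0" using card_F_pos by simp
  have L: "L = F (Suc m) False" unfolding L_def nm by (rule Lg_eq_F) simp
  have cardL: "card L = 12 * card (F m False) ^ 3" unfolding L by (rule card_F_Suc[OF m])
  have dist_eq: "process_dist m {#(Ts, 1)#} = cycle_dist m False"
    "process_dist m {#(Tn, 1)#} = cycle_dist m True"
    by (simp_all add: cycle_dist_eq_process_dist)
  \<comment> \<open>Each cell has one twelfth of the elements of \<open>L\<close>, so CD of a union
    of cells is a sum of their distributions with weight 1/12.\<close>
  have CD_cells: "CD n (\<Union>(k, \<epsilon>)\<in>I. cell m \<epsilon> False k) L p =
      1/12 * (\<Sum>(k, \<epsilon>)\<in>I. pmf (cell_dist m \<epsilon> False k) p)"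
    if "finite I" for I p
    using c card_cycle_type_cells(2)[OF that disjoint_cells[OF m] refl, of False p]
    by (simp add: CD_def nm cardL)

  have H: "H = cell m (\<lambda>_. False) False 0" unfolding H_def nm by (rule Hg_eq_cell[OF m])
  have nx0: "\<not> xor3 (\<lambda>_. False)" by (simp add: xor3_const)
  \<comment> \<open>\<open>H\<close> is a single cell. The remaining \<open>n - 1 = m\<close> steps
    of the process act on its three even components.\<close>
  have 1: "CD n H L p = A1 n p" for p
    using CD_cells[of "{(0, \<lambda>_. False)}" p] dist_eq
    by (simp add: H A1_def D_def nm cell_dist_identity[OF nx0] process_dist_add_mset flip: process_dist_def)

  have x: "x \<in> cell m (\<lambda>_. False) False 1" unfolding x_def nm by (rule xg_cell_F(2))
  have "x2 = x \<circ> x" unfolding x2_def G_def by (simp add: numeral_2_eq_2 nat_pow_def)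
  then have x2: "x2 \<in> cell m (\<lambda>_. False) False 2" using cell_mult_even[OF x x] by simp
  have K: "K = even_cells m 0" unfolding K_def nm by (rule Kg_eq_even_cells[OF m])
  have Kx: "K #>\<^bsub>G\<^esub> x = even_cells m 1"
    using even_cells_shift[OF x, of 0] by (auto simp: r_coset_def K G_def)
  have Kx2: "K #>\<^bsub>G\<^esub> x2 = even_cells m 2"
    using even_cells_shift[OF x2, of 0] by (auto simp: r_coset_def K G_def)
  have 2: "(K #>\<^bsub>G\<^esub> x) \<inter> (K #>\<^bsub>G\<^esub> x2) = {}"
  proof (rule equals0I)
    fix s assume "s \<in> (K #>\<^bsub>G\<^esub> x) \<inter> (K #>\<^bsub>G\<^esub> x2)"
    then obtain \<epsilon> \<delta> where "s \<in> cell m \<epsilon> False 1" "s \<in> cell m \<delta> False 2"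
      unfolding Kx Kx2 even_cells_def by blast
    from cell_index_unique(1)[OF this] show False by simp
  qed
  have 3: "CD n ((K #>\<^bsub>G\<^esub> x) \<union> (K #>\<^bsub>G\<^esub> x2)) L p = A2 n p" for p
  proof -
    let ?E = "{\<epsilon>. xor3 \<epsilon> = False}"
    have "(K #>\<^bsub>G\<^esub> x) \<union> (K #>\<^bsub>G\<^esub> x2) = (\<Union>(k, \<epsilon>)\<in>{1, 2} \<times> ?E. cell m \<epsilon> False k)"
      unfolding Kx Kx2 even_cells_def by auto
    moreover have "finite ({1, 2::3} \<times> ?E)" by (simp add: xor3_set)
    ultimately have "CD n ((K #>\<^bsub>G\<^esub> x) \<union> (K #>\<^bsub>G\<^esub> x2)) L p =
        1/12 * (\<Sum>(k, \<epsilon>)\<in>{1, 2} \<times> ?E. pmf (cell_dist m \<epsilon> False k) p)"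
      using CD_cells by simp
    also have "(\<Sum>(k, \<epsilon>)\<in>{1, 2} \<times> ?E. pmf (cell_dist m \<epsilon> False k) p) =
        (\<Sum>(k, \<epsilon>)\<in>{1, 2::3} \<times> ?E. pmf (map_pmf (image_mset ((*) 3)) (cycle_dist m False)) p)"
      by (intro sum.cong refl) (auto simp: cell_dist_three_cycle)
    \<comment> \<open>Two rotations times four sign patterns; 8/12 is the weight 2/3 of
      \<open>A2\<close>.\<close>
    also have "\<dots> = 8 * pmf (map_pmf (image_mset ((*) 3)) (cycle_dist m False)) p"
      by (simp add: case_prod_unfold card_cartesian_product card_xor3[of False, simplified])
    finally show ?thesis
      using process_dist_scale[of m Ts 3 1] dist_eq by (simp add: A2_def D_def nm flip: process_dist_def)
  qed

  have z: "z \<in> cell m (tri True True False) False 0" unfolding z_def nm by (rule zg_cell)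
  have v: "(\<lambda>i. tri True True False (1 + i)) = tri True False True"
    "(\<lambda>i. tri True True False (2 + i)) = tri False True True"
    unfolding fun_eq_iff all_three by (simp_all add: tri_def)
  have nx: "\<not> xor3 (tri True True False)" "\<not> xor3 (tri True False True)" "\<not> xor3 (tri False True True)"
    by (simp_all add: xor3_def)
  have C0: "C0 = cell m (tri True True False) False 0"
    unfolding C0_def H G_def nm by (rule coset_cell[OF z nx(1)])
  have C1: "C1 = cell m (tri True False True) False 0"
    unfolding C1_def H G_def nm
    using coset_cell[OF conj_cell[OF x nx0 z, unfolded v] nx(2)] .
  have C2: "C2 = cell m (tri False True True) False 0"
    unfolding C2_def H G_def nm
    using coset_cell[OF conj_cell[OF x2 nx0 z, unfolded v] nx(3)] .
  have 4: "C0 \<inter> C1 = {}" "C0 \<inter> C2 = {}" "C1 \<inter> C2 = {}"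
    unfolding C0 C1 C2 using cell_index_unique(2)[OF _ _ m] by fastforce+
  have 5: "CD n (C0 \<union> C1 \<union> C2) L p = A3 n p" for p
  proof -
    \<comment> \<open>The three patterns with two odd components over the identity; 3/12 is the
      weight 1/4 of \<open>A3\<close>.\<close>
    let ?I = "{(0::3, tri True True False), (0, tri True False True), (0, tri False True True)}"
    have "C0 \<union> C1 \<union> C2 = (\<Union>(k, \<epsilon>)\<in>?I. cell m \<epsilon> False k)" unfolding C0 C1 C2 by auto
    then have "CD n (C0 \<union> C1 \<union> C2) L p = 1/12 * (\<Sum>(k, \<epsilon>)\<in>?I. pmf (cell_dist m \<epsilon> False k) p)"
      using CD_cells[of ?I p] by simp
    then show ?thesis
      using dist_eq by (simp add: A3_def D_def nm cell_dist_identity nx process_dist_add_mset conv_ac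
          flip: process_dist_def)
  qed

  have M: "M = F (Suc m) False \<union> F (Suc m) True"
    unfolding M_def n m_def by (rule Mg_eq_F)
  \<comment> \<open>The even and odd halves of \<open>M\<close> are equally large, which is the
    source of the weight 1/2 in \<open>A4\<close>.\<close>
  have cardM: "card M = 2 * card (F (Suc m) True)"
    unfolding M using F_disjoint[of "Suc m"] card_F[of "Suc m" True]
    by (subst card_Un_disjoint) (auto simp: finite_F)
  have Ly: "L #>\<^bsub>G\<^esub> y = F (Suc m) True"
    unfolding L G_def y_def nm by (rule F_True_coset[symmetric])
  have 6: "CD n (L #>\<^bsub>G\<^esub> y) M p = A4 (n + 1) p" for p
  proof -
    have "real (card {\<sigma> \<in> F (Suc m) True. cycle_type (Suc m) \<sigma> = p}) =
        real (card (F (Suc m) True)) * pmf (cycle_dist (Suc m) True) p"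
      unfolding cycle_dist_def unif_def by (rule card_filter_eq_pmf[OF finite_F F_nonempty])
    then have "CD n (L #>\<^bsub>G\<^esub> y) M p = 1/2 * pmf (cycle_dist (Suc m) True) p"
      using card_F_pos[of "Suc m" True] by (simp add: CD_def Ly cardM nm)
    \<comment> \<open>\<open>A4 (n + 1)\<close> runs \<open>n = Suc m\<close> steps: starting from
      one odd pair, the process also performs the step at the root.\<close>
    then show ?thesis
      unfolding cycle_dist_eq_process_dist by (simp add: A4_def D_def nm process_dist_def)
  qed
  show ?thesis using 1 2 3 4 5 6 by blast
qed

end
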